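(* Fix an integer $k\ge 1$. (i) If $k$ is even, then $|\text{Möb}^{+}(n)|_k \asymp n$. (ii) If $k$ is odd, then $|\text{Möb}(n)|_k \asymp n$. Here $n$ ranges over the integers $n\geq 2$ with $n \ge k+1$, and $f(n)\asymp n$ means that there are constants $c, C>0$ (depending on $k$ but not on $n$) with $c\,n \le f(n)\le C\,n$ for all such $n$.
   Context: $\mathbb{H}^n$ is hyperbolic $n$-space, $\text{Möb}(n)$ is its full isometry group, and $\text{Möb}^{+}(n)$ is the subgroup of orientation preserving isometries. An involution is an isometry of $\mathbb{H}^n$ of order two; its fixed point set is a totally geodesic subspace. A $k$-involution is an involution whose fixed point set has codimension $k$, and $S_k \subset \text{Möb}(n)$ is the set of all $k$-involutions. Let $G$ be a group and $S$ a symmetric set of generators of a group containing $G$. For $g\in G$, the $S$-length of $g$ is the minimal number of elements of $S$ needed to express $g$ as their product. The $S$-length of $G$ is the supremum of the $S$-lengths of all $g \in G$. $|G|_k$ denotes the $S_k$-length of $G$. *)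

theory Defs
  imports
    "HOL-Algebra.Bij"
    "HOL-Algebra.Multiplicative_Group"
    "HOL-Library.Extended_Real"
    "Jordan_Normal_Form.Determinant"
    "Jordan_Normal_Form.VS_Connect"
begin

section \<open>Word length\<close>

text \<open>The length is \<open>\<infinity>\<close> for an element that is not a product of elements of \<open>S\<close> (infimum of
  the empty set); the empty product is the identity and has length 0.\<close>

definition word_length :: "('a, 'b) monoid_scheme \<Rightarrow> 'a set \<Rightarrow> 'a \<Rightarrow> enat" where
  "word_length M S g =
     Inf {enat (length ws) | ws. set ws \<subseteq> S \<and> foldr (\<lambda>x y. x \<otimes>\<^bsub>M\<^esub> y) ws \<one>\<^bsub>M\<^esub> = g}"

definition set_length :: "('a, 'b) monoid_scheme \<Rightarrow> 'a set \<Rightarrow> 'a set \<Rightarrow> enat" where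
  "set_length M S G = (SUP g\<in>G. word_length M S g)"


section \<open>Hyperbolic space\<close>

text \<open>The hyperboloid model in \<open>\<real>\<^sup>n\<^sup>+\<^sup>1\<close>, with coordinates indexed by \<open>0, \<dots>, n\<close> and
  coordinate 0 the time-like one.\<close>

definition lorentz :: "real vec \<Rightarrow> real vec \<Rightarrow> real" where
  "lorentz x y = (\<Sum>i = 1..<dim_vec x. x $ i * y $ i) - x $ 0 * y $ 0"

definition hyp_space :: "nat \<Rightarrow> real vec set" where
  "hyp_space n = {x \<in> carrier_vec (n + 1). lorentz x x = - 1 \<and> x $ 0 > 0}"

definition hyp_dist :: "real vec \<Rightarrow> real vec \<Rightarrow> real" where
  "hyp_dist x y = arcosh (- lorentz x y)"

text \<open>The totally geodesic subspaces of dimension \<open>d\<close> are the nonempty intersections of the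
  hyperboloid with linear subspaces of dimension \<open>d + 1\<close>; the linear subspace is given by
  a basis \<open>B\<close>.\<close>

definition tot_geodesic :: "nat \<Rightarrow> nat \<Rightarrow> real vec set \<Rightarrow> bool" where
  "tot_geodesic n d F \<longleftrightarrow>
     F \<noteq> {} \<and>
     (\<exists>B \<subseteq> carrier_vec (n + 1).
        card B = d + 1 \<and>
        \<not> LinearCombinations.module.lin_dep class_ring (module_vec TYPE(real) (n + 1)) B \<and>
        F = hyp_space n \<inter>
            LinearCombinations.module.span class_ring (module_vec TYPE(real) (n + 1)) B)"


section \<open>The Moebius group\<close>

text \<open>Isometries are extensional functions, undefined outside the hyperboloid, so that
  distinct elements of the group are distinct as maps of hyperbolic space.\<close>

definition Mob :: "nat \<Rightarrow> (real vec \<Rightarrow> real vec) monoid" where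
  "Mob n = BijGroup (hyp_space n)
     \<lparr>carrier := {f \<in> Bij (hyp_space n).
        \<forall>x \<in> hyp_space n. \<forall>y \<in> hyp_space n. hyp_dist (f x) (f y) = hyp_dist x y}\<rparr>"

text \<open>The columns of \<open>X\<close> are the vertices of an oriented geodesic \<open>n\<close>-simplex, and the sign of
  \<open>det X\<close> is its orientation: the central projection \<open>x \<mapsto> x / x\<^sub>0\<close> to the projective (Klein)
  model has \<open>x\<^sub>0 > 0\<close>, so it does not change this sign, and it turns \<open>det X\<close> into the usual
  orientation determinant of an affine simplex in \<open>\<real>\<^sup>n\<close>. Degenerate simplices have determinant 0.\<close>

definition orientation_preserving :: "nat \<Rightarrow> (real vec \<Rightarrow> real vec) \<Rightarrow> bool" where
  "orientation_preserving n f \<longleftrightarrow>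
     (\<forall>X \<in> carrier_mat (n + 1) (n + 1).
        set (cols X) \<subseteq> hyp_space n \<and> det X > 0 \<longrightarrow>
        det (mat_of_cols (n + 1) (map f (cols X))) > 0)"

definition Mob_plus :: "nat \<Rightarrow> (real vec \<Rightarrow> real vec) set" where
  "Mob_plus n = {f \<in> carrier (Mob n). orientation_preserving n f}"

lemma Mob_group: "group (Mob n)"
proof -
  let ?H = "hyp_space n"
  let ?C = "{f \<in> Bij ?H. \<forall>x \<in> ?H. \<forall>y \<in> ?H. hyp_dist (f x) (f y) = hyp_dist x y}"
  interpret B: group "BijGroup ?H" by (rule group_BijGroup)
  have car: "carrier (BijGroup ?H) = Bij ?H" by (simp add: BijGroup_def)
  have maps: "f x \<in> ?H" if "f \<in> Bij ?H" "x \<in> ?H" for f x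
    using that Bij_imp_funcset by blast
  have "subgroup ?C (BijGroup ?H)"
  proof (rule B.subgroupI)
    show "?C \<subseteq> carrier (BijGroup ?H)" by (auto simp: car)
    have "(\<lambda>x\<in>?H. x) \<in> ?C" by (auto simp: id_Bij)
    then show "?C \<noteq> {}" by blast
  next
    fix f assume f: "f \<in> ?C"
    then have fB: "f \<in> Bij ?H" by simp
    have inv: "inv\<^bsub>BijGroup ?H\<^esub> f = (\<lambda>x\<in>?H. inv_into ?H f x)" by (rule inv_BijGroup[OF fB])
    have surj: "f ` ?H = ?H" using fB by (simp add: Bij_def bij_betw_def)
    show "inv\<^bsub>BijGroup ?H\<^esub> f \<in> ?C"
      unfolding inv
    proof (safe)
      show "(\<lambda>x\<in>?H. inv_into ?H f x) \<in> Bij ?H" by (rule restrict_inv_into_Bij[OF fB])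
      fix x y assume xy: "x \<in> ?H" "y \<in> ?H"
      have m: "inv_into ?H f x \<in> ?H" "inv_into ?H f y \<in> ?H"
        using xy fB by (auto intro: Bij_inv_into_mem)
      have "f (inv_into ?H f x) = x" "f (inv_into ?H f y) = y"
        using xy surj by (auto intro: f_inv_into_f)
      then have "hyp_dist (inv_into ?H f x) (inv_into ?H f y) = hyp_dist x y"
        using f m by force
      then show "hyp_dist ((\<lambda>x\<in>?H. inv_into ?H f x) x) ((\<lambda>x\<in>?H. inv_into ?H f x) y)
                  = hyp_dist x y"
        using xy by simp
    qed
  next
    fix f g assume "f \<in> ?C" "g \<in> ?C"
    then show "f \<otimes>\<^bsub>BijGroup ?H\<^esub> g \<in> ?C"
      using maps by (auto simp: BijGroup_def compose_Bij) (simp add: compose_def)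
  qed
  then show ?thesis
    unfolding Mob_def by (rule B.subgroup_imp_group)
qed


section \<open>Involutions\<close>

definition fixed_points :: "nat \<Rightarrow> (real vec \<Rightarrow> real vec) \<Rightarrow> real vec set" where
  "fixed_points n f = {x \<in> hyp_space n. f x = x}"

definition k_involutions :: "nat \<Rightarrow> nat \<Rightarrow> (real vec \<Rightarrow> real vec) set" where
  "k_involutions k n = {f \<in> carrier (Mob n).
     group.ord (Mob n) f = 2 \<and> (\<exists>d. d + k = n \<and> tot_geodesic n d (fixed_points n f))}"

definition inv_length :: "nat \<Rightarrow> nat \<Rightarrow> (real vec \<Rightarrow> real vec) set \<Rightarrow> enat" where
  "inv_length k n G = set_length (Mob n) (k_involutions k n) G"

end

theory Submission
  imports Defs
begin

text \<open>Everything is expressed through reflections in spacelike vectors of the Lorentz form on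
  \<open>\<real>\<^sup>n\<^sup>+\<^sup>1\<close>. A reflection in \<open>v\<close> fixes the hyperplane orthogonal to \<open>v\<close>, and a composition of \<open>k\<close>
  reflections in pairwise orthogonal vectors is a \<open>k\<close>-involution (\<open>k_involution_mob\<close>).

  Upper bound. By the argument of Cartan and Dieudonne, every isometry is a product of at most
  \<open>n + 1\<close> reflections (\<open>Mob_reflections\<close>): one spanning point of the hyperboloid after another is
  moved back to its place by one reflection. The parity of the number of factors is the orientation
  behaviour (\<open>orientation_preserving_mob\<close>), since a reflection has determinant \<open>- 1\<close>. It remains to
  write reflections by boundedly many \<open>k\<close>-involutions. Because \<open>k + 1 \<le> n\<close>, two orthogonal
  spacelike vectors \<open>u\<close> and \<open>v\<close> have a common set \<open>W\<close> of \<open>k - 1\<close> further spacelike vectors that are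
  orthogonal to both and to each other;
  the \<open>k\<close>-involutions of \<open>u, W\<close> and of \<open>W, v\<close> have the product \<open>r\<^sub>u r\<^sub>v\<close>, because the reflections in \<open>W\<close>
  cancel. For \<open>k \<ge> 2\<close>, two arbitrary vectors have a common orthogonal spacelike vector \<open>w\<close>, and
  \<open>r\<^sub>u r\<^sub>v = r\<^sub>u r\<^sub>w r\<^sub>w r\<^sub>v\<close> costs four \<open>k\<close>-involutions; this settles even products, hence even \<open>k\<close>.
  For odd \<open>k\<close>, a single reflection is a \<open>k\<close>-involution times an even orthogonal product.

  Lower bound. A \<open>k\<close>-involution, extended linearly, fixes all vectors orthogonal to some \<open>k\<close> given
  ones (\<open>k_involution_fixes\<close>), so a product of \<open>l\<close> of them fixes all vectors orthogonal to \<open>k l\<close> given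
  ones. The map negating the first \<open>m\<close> spatial coordinates has no nonzero fixed vector among those
  supported on these coordinates, which forces \<open>m \<le> k l\<close>. Taking \<open>m\<close> even and at least \<open>n / 2\<close> gives
  an orientation preserving isometry, which serves both parities of \<open>k\<close>.\<close>

section \<open>The Lorentz form and the hyperboloid\<close>

lemma lorentz_comm: "dim_vec x = dim_vec y \<Longrightarrow> lorentz x y = lorentz y x"
  by (simp add: lorentz_def mult.commute)

lemma lorentz_add_left:
  assumes "x \<in> carrier_vec (n + 1)" "y \<in> carrier_vec (n + 1)"
  shows "lorentz (x + y) z = lorentz x z + lorentz y z"
proof -
  have "(\<Sum>i = 1..<n + 1. (x + y) $ i * z $ i) = (\<Sum>i = 1..<n + 1. x $ i * z $ i + y $ i * z $ i)"
    using assms by (intro sum.cong) (auto simp: distrib_right)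
  then show ?thesis
    using assms by (simp add: lorentz_def sum.distrib algebra_simps)
qed

lemma lorentz_smult_left:
  assumes "x \<in> carrier_vec (n + 1)"
  shows "lorentz (a \<cdot>\<^sub>v x) z = a * lorentz x z"
proof -
  have "(\<Sum>i = 1..<n + 1. (a \<cdot>\<^sub>v x) $ i * z $ i) = (\<Sum>i = 1..<n + 1. a * (x $ i * z $ i))"
    using assms by (intro sum.cong) auto
  then show ?thesis
    using assms
    by (simp add: lorentz_def sum_distrib_left right_diff_distrib del: sum.op_ivl_Suc)
qed

lemma lorentz_diff_left:
  assumes "x \<in> carrier_vec (n + 1)" "y \<in> carrier_vec (n + 1)"
  shows "lorentz (x - y) z = lorentz x z - lorentz y z"
proof -
  have "(\<Sum>i = 1..<n + 1. (x - y) $ i * z $ i) = (\<Sum>i = 1..<n + 1. x $ i * z $ i - y $ i * z $ i)"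
    using assms by (intro sum.cong) (auto simp: left_diff_distrib)
  then show ?thesis
    using assms by (simp add: lorentz_def sum_subtractf algebra_simps)
qed

lemma lorentz_add_right:
  assumes "x \<in> carrier_vec (n + 1)" "y \<in> carrier_vec (n + 1)" "z \<in> carrier_vec (n + 1)"
  shows "lorentz z (x + y) = lorentz z x + lorentz z y"
  using lorentz_add_left[OF assms(1,2), of z] assms
  by (simp add: lorentz_comm[of z x] lorentz_comm[of z y] lorentz_comm[of z "x + y"])

lemma lorentz_diff_right:
  assumes "x \<in> carrier_vec (n + 1)" "y \<in> carrier_vec (n + 1)" "z \<in> carrier_vec (n + 1)"
  shows "lorentz z (x - y) = lorentz z x - lorentz z y"
  using lorentz_diff_left[OF assms(1,2), of z] assms
  by (simp add: lorentz_comm[of z x] lorentz_comm[of z y] lorentz_comm[of z "x - y"])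

lemma lorentz_smult_right:
  assumes "x \<in> carrier_vec (n + 1)" "z \<in> carrier_vec (n + 1)"
  shows "lorentz z (a \<cdot>\<^sub>v x) = a * lorentz z x"
  using lorentz_smult_left[OF assms(1), of a z] assms
  by (simp add: lorentz_comm[of z x] lorentz_comm[of z "a \<cdot>\<^sub>v x"])

lemmas lorentz_linear =
  lorentz_add_left lorentz_add_right lorentz_diff_left lorentz_diff_right
  lorentz_smult_left lorentz_smult_right

lemma lorentz_unit_0:
  assumes "x \<in> carrier_vec (n + 1)"
  shows "lorentz x (unit_vec (n + 1) 0) = - x $ 0"
  using assms by (simp add: lorentz_def)

lemma lorentz_unit_pos:
  assumes "x \<in> carrier_vec (n + 1)" "0 < i" "i < n + 1"
  shows "lorentz x (unit_vec (n + 1) i) = x $ i"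
proof -
  have "(\<Sum>j = 1..<n + 1. x $ j * unit_vec (n + 1) i $ j) = (\<Sum>j = 1..<n + 1. if j = i then x $ j else 0)"
    using assms by (intro sum.cong) (auto simp: unit_vec_def)
  also have "\<dots> = x $ i" using assms by simp
  finally show ?thesis using assms by (simp add: lorentz_def)
qed

lemma lorentz_nondegenerate:
  assumes x: "x \<in> carrier_vec (n + 1)"
    and "\<And>i. i < n + 1 \<Longrightarrow> lorentz x (unit_vec (n + 1) i) = 0"
  shows "x = 0\<^sub>v (n + 1)"
proof (rule eq_vecI)
  show "x $ i = 0\<^sub>v (n + 1) $ i" if "i < dim_vec (0\<^sub>v (n + 1))" for i
    using that assms lorentz_unit_0[OF x] lorentz_unit_pos[OF x, of i] by (cases "i = 0") auto
qed (use x in auto)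

definition spacelike :: "nat \<Rightarrow> real vec set" where
  "spacelike n = {v \<in> carrier_vec (n + 1). lorentz v v > 0}"

lemma spacelikeD: "v \<in> spacelike n \<Longrightarrow> v \<in> carrier_vec (n + 1)" "v \<in> spacelike n \<Longrightarrow> lorentz v v > 0"
  by (auto simp: spacelike_def)

lemma hyp_spaceD:
  "x \<in> hyp_space n \<Longrightarrow> x \<in> carrier_vec (n + 1)"
  "x \<in> hyp_space n \<Longrightarrow> lorentz x x = - 1"
  "x \<in> hyp_space n \<Longrightarrow> x $ 0 > 0"
  by (auto simp: hyp_space_def)

text \<open>On the hyperplane of time coordinate 0 the form is the Euclidean one. The definiteness
  properties below reduce to this case by a linear combination that cancels the time coordinate.\<close>
lemma lorentz_time_zero:
  assumes "x \<in> carrier_vec (n + 1)" "x $ 0 = 0"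
  shows "lorentz x x \<ge> 0" "lorentz x x = 0 \<Longrightarrow> x = 0\<^sub>v (n + 1)"
proof -
  have e: "lorentz x x = (\<Sum>i = 1..<n + 1. (x $ i)\<^sup>2)"
    using assms by (simp add: lorentz_def power2_eq_square)
  show "lorentz x x \<ge> 0" unfolding e by (intro sum_nonneg) auto
  assume "lorentz x x = 0"
  then have "\<forall>i\<in>{1..<n + 1}. (x $ i)\<^sup>2 = 0"
    unfolding e by (subst (asm) sum_nonneg_eq_0_iff) auto
  then have z: "x $ i = 0" if "i < n + 1" for i
    using that assms(2) by (cases "i = 0") auto
  show "x = 0\<^sub>v (n + 1)"
    by (rule eq_vecI) (use z assms(1) in auto)
qed

lemma spacelike_time_zero:
  assumes "x \<in> carrier_vec (n + 1)" "x $ 0 = 0" "x \<noteq> 0\<^sub>v (n + 1)"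
  shows "x \<in> spacelike n"
  using assms lorentz_time_zero[OF assms(1,2)] by (force simp: spacelike_def)

lemma spacelike_unit: "0 < i \<Longrightarrow> i < n + 1 \<Longrightarrow> unit_vec (n + 1) i \<in> spacelike n"
  using lorentz_unit_pos[of "unit_vec (n + 1) i" n i] by (auto simp: spacelike_def)

text \<open>The reversed Cauchy-Schwarz inequality: the combination of \<open>x\<close> and \<open>y\<close> with time coordinate 0
  has nonnegative square.\<close>
lemma hyp_lorentz:
  assumes x: "x \<in> hyp_space n" and y: "y \<in> hyp_space n"
  shows "lorentz x y \<le> - 1" "lorentz x y = - 1 \<Longrightarrow> x = y"
proof -
  note xD = hyp_spaceD[OF x] and yD = hyp_spaceD[OF y]
  define w where "w = y $ 0 \<cdot>\<^sub>v x - x $ 0 \<cdot>\<^sub>v y"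
  have w: "w \<in> carrier_vec (n + 1)" "w $ 0 = 0" using xD yD by (auto simp: w_def)
  have yx: "lorentz y x = lorentz x y" using xD yD by (simp add: lorentz_comm)
  have ww: "lorentz w w = - (y $ 0)\<^sup>2 - (x $ 0)\<^sup>2 - 2 * (x $ 0 * y $ 0) * lorentz x y"
    unfolding w_def using xD yD
    by (simp add: lorentz_linear[of _ n] yx) (simp add: algebra_simps power2_eq_square)
  have ww': "lorentz w w = - (x $ 0 - y $ 0)\<^sup>2 - 2 * ((x $ 0 * y $ 0) * (lorentz x y + 1))"
    unfolding ww by (simp add: power2_eq_square algebra_simps)
  have p: "x $ 0 * y $ 0 > 0" using xD yD by simp
  have "0 \<le> lorentz w w" using lorentz_time_zero[OF w] by simp
  then have "(x $ 0 * y $ 0) * (lorentz x y + 1) \<le> 0"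
    unfolding ww' using zero_le_power2[of "x $ 0 - y $ 0"] by linarith
  then have "lorentz x y + 1 \<le> 0" using mult_pos_pos[OF p] by (meson not_le)
  then show "lorentz x y \<le> - 1" by simp
  assume eq: "lorentz x y = - 1"
  with ww' \<open>0 \<le> lorentz w w\<close> have "(x $ 0 - y $ 0)\<^sup>2 \<le> 0" by simp
  then have e: "x $ 0 = y $ 0" by simp
  then have "lorentz w w = 0" using ww' eq by simp
  then have "w = 0\<^sub>v (n + 1)" using lorentz_time_zero[OF w] by simp
  then have "w $ i = 0" if "i < n + 1" for i
    using that by simp
  then have "y $ 0 * x $ i = x $ 0 * y $ i" if "i < n + 1" for i
    using that xD yD by (simp add: w_def)
  then show "x = y"
    using xD yD e by (intro eq_vecI) auto
qed

text \<open>The Lorentz form has only one negative direction, so it is positive definite on the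
  orthogonal complement of a point of the hyperboloid.\<close>
lemma spacelike_orthogonal_timelike:
  assumes p: "p \<in> hyp_space n" and v: "v \<in> carrier_vec (n + 1)"
    and o: "lorentz v p = 0" and nz: "v \<noteq> 0\<^sub>v (n + 1)"
  shows "v \<in> spacelike n"
proof (cases "v $ 0 = 0")
  case True then show ?thesis using spacelike_time_zero v nz by blast
next
  case False
  note pD = hyp_spaceD[OF p]
  define w where "w = p $ 0 \<cdot>\<^sub>v v - v $ 0 \<cdot>\<^sub>v p"
  have w: "w \<in> carrier_vec (n + 1)" "w $ 0 = 0" using pD v by (auto simp: w_def)
  have "lorentz p v = 0" using o pD v by (simp add: lorentz_comm)
  then have "lorentz w w = (p $ 0)\<^sup>2 * lorentz v v - (v $ 0)\<^sup>2"
    unfolding w_def using pD v o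
    by (simp add: lorentz_linear[of _ n]) (simp add: algebra_simps power2_eq_square)
  then have "(p $ 0)\<^sup>2 * lorentz v v > 0"
    using lorentz_time_zero(1)[OF w] False zero_less_power2[of "v $ 0"] by linarith
  then show ?thesis using v by (simp add: spacelike_def zero_less_mult_iff)
qed

lemma base_point: "unit_vec (n + 1) 0 \<in> hyp_space n"
  by (simp add: hyp_space_def lorentz_unit_0[of "unit_vec (Suc n) 0" n, simplified])

lemma hyp_diff_spacelike:
  assumes x: "x \<in> hyp_space n" and y: "y \<in> hyp_space n" and "x \<noteq> y"
  shows "x - y \<in> spacelike n"
proof -
  note xD = hyp_spaceD[OF x] and yD = hyp_spaceD[OF y]
  have "lorentz y x = lorentz x y" using xD yD by (simp add: lorentz_comm)
  then have "lorentz (x - y) (x - y) = - 2 - 2 * lorentz x y"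
    using xD yD by (simp add: lorentz_linear[of _ n])
  moreover have "lorentz x y < - 1" using hyp_lorentz[OF x y] assms(3) by fastforce
  ultimately show ?thesis using xD yD by (simp add: spacelike_def)
qed

lemma timelike_scale:
  assumes x: "x \<in> carrier_vec (n + 1)" and neg: "lorentz x x < 0" and pos: "x $ 0 > 0"
  obtains c where "c > 0" "c \<cdot>\<^sub>v x \<in> hyp_space n"
proof
  let ?c = "1 / sqrt (- lorentz x x)"
  show "?c > 0" using neg by simp
  have "?c * ?c * lorentz x x = - 1" using neg by (simp add: field_simps)
  then show "?c \<cdot>\<^sub>v x \<in> hyp_space n"
    using x neg pos by (simp add: hyp_space_def lorentz_linear[of _ n] mult.assoc)
qed

text \<open>The timelike cone is open. Hence a linear subspace that meets the hyperboloid is spanned by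
  its points on the hyperboloid, and linear maps are determined by their values there.\<close>
lemma hyp_perturb:
  assumes p: "p \<in> hyp_space n" and x: "x \<in> carrier_vec (n + 1)"
  obtains c e where "c > 0" "e > 0" "c \<cdot>\<^sub>v (p + e \<cdot>\<^sub>v x) \<in> hyp_space n"
proof -
  note pD = hyp_spaceD[OF p]
  have "lorentz x p = lorentz p x" using x pD by (simp add: lorentz_comm)
  then have q: "lorentz (p + e \<cdot>\<^sub>v x) (p + e \<cdot>\<^sub>v x) = - 1 + 2 * e * lorentz p x + e\<^sup>2 * lorentz x x" for e
    using pD x by (simp add: lorentz_linear[of _ n] power2_eq_square algebra_simps)
  have "((\<lambda>e. - 1 + 2 * e * lorentz p x + e\<^sup>2 * lorentz x x) \<longlongrightarrow> - 1 + 2 * 0 * lorentz p x + 0\<^sup>2 * lorentz x x) (at_right 0)"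
    by (intro tendsto_intros)
  then have 1: "\<forall>\<^sub>F e in at_right 0. - 1 + 2 * e * lorentz p x + e\<^sup>2 * lorentz x x < 0"
    by (rule order_tendstoD) simp
  have "((\<lambda>e. p $ 0 + e * x $ 0) \<longlongrightarrow> p $ 0 + 0 * x $ 0) (at_right 0)"
    by (intro tendsto_intros)
  then have 2: "\<forall>\<^sub>F e in at_right 0. p $ 0 + e * x $ 0 > 0"
    by (rule order_tendstoD) (use pD in simp)
  have 3: "\<forall>\<^sub>F e in at_right (0::real). e > 0" by (simp add: eventually_at_right_less)
  from eventually_happens'[OF _ eventually_conj[OF 1 eventually_conj[OF 2 3]]]
  obtain e where e: "- 1 + 2 * e * lorentz p x + e\<^sup>2 * lorentz x x < 0" "p $ 0 + e * x $ 0 > 0" "e > 0"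
    by (metis trivial_limit_at_right_real)
  have "p + e \<cdot>\<^sub>v x \<in> carrier_vec (n + 1)" "(p + e \<cdot>\<^sub>v x) $ 0 > 0"
    using pD x e by auto
  from timelike_scale[OF this(1) _ this(2)] e q that show thesis by metis
qed

text \<open>Fewer than \<open>n + 1\<close> linear equations in \<open>n + 1\<close> unknowns have a nonzero solution. It yields
  the orthogonal vectors chosen below as well as the test vector of the lower bound.\<close>
lemma exists_orthogonal:
  assumes L: "set L \<subseteq> carrier_vec (n + 1)" and len: "length L < n + 1"
  obtains x where "x \<in> carrier_vec (n + 1)" "x \<noteq> 0\<^sub>v (n + 1)" "\<And>u. u \<in> set L \<Longrightarrow> lorentz x u = 0"
proof -
  let ?N = "n + 1"
  \<comment> \<open>The equations are padded with zero rows; the minus sign in column 0 is that of the form.\<close>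
  define A where "A = mat ?N ?N (\<lambda>(i, j). if i < length L then (if j = 0 then - (L ! i $ 0) else L ! i $ j) else 0)"
  have A: "A \<in> carrier_mat ?N ?N" by (simp add: A_def)
  have "row A n = 0\<^sub>v ?N" using len by (intro eq_vecI) (auto simp: A_def)
  have "det A = (\<Sum>j<?N. A $$ (n, j) * cofactor A n j)"
    by (rule laplace_expansion_row[OF A]) simp
  also have "\<dots> = 0"
    by (rule sum.neutral) (use len in \<open>auto simp: A_def\<close>)
  finally have "det A = 0" .
  with det_0_iff_vec_prod_zero[OF A] obtain x where x: "x \<in> carrier_vec ?N" "x \<noteq> 0\<^sub>v ?N"
    and Ax: "A *\<^sub>v x = 0\<^sub>v ?N" by auto
  have "lorentz x u = 0" if u: "u \<in> set L" for u
  proof -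
    from u obtain i where i: "i < length L" "u = L ! i" by (auto simp: in_set_conv_nth)
    have ud: "dim_vec u = ?N" using u L by auto
    have "0 = (A *\<^sub>v x) $ i" unfolding Ax using i len by simp
    also have "\<dots> = (\<Sum>j = 0..<?N. A $$ (i, j) * x $ j)"
      using i len x A by (simp add: scalar_prod_def)
    also have "\<dots> = A $$ (i, 0) * x $ 0 + (\<Sum>j = 1..<?N. A $$ (i, j) * x $ j)"
      by (subst sum.atLeast_Suc_lessThan) simp_all
    also have "(\<Sum>j = 1..<?N. A $$ (i, j) * x $ j) = (\<Sum>j = 1..<?N. x $ j * u $ j)"
      using i len by (intro sum.cong) (auto simp: A_def)
    also have "A $$ (i, 0) * x $ 0 = - (x $ 0 * u $ 0)"
      using i len by (simp add: A_def)
    finally show ?thesis using x by (simp add: lorentz_def)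
  qed
  with x that show thesis by blast
qed

text \<open>Successive choice of orthogonal vectors. The hypothesis on \<open>L\<close> holds, for instance, when a
  point of the hyperboloid lies in the span of \<open>L\<close>; it makes every new vector spacelike, so that there
  is a reflection in it.\<close>
lemma orthogonal_extension:
  assumes L: "set L \<subseteq> carrier_vec (n + 1)"
    and sp: "\<And>v. v \<in> carrier_vec (n + 1) \<Longrightarrow> v \<noteq> 0\<^sub>v (n + 1) \<Longrightarrow> (\<And>u. u \<in> set L \<Longrightarrow> lorentz v u = 0) \<Longrightarrow> v \<in> spacelike n"
    and len: "length L + m \<le> n + 1"
  obtains vs where "length vs = m" "set vs \<subseteq> spacelike n" "sorted_wrt (\<lambda>u v. lorentz u v = 0) vs"
    "\<And>u v. u \<in> set L \<Longrightarrow> v \<in> set vs \<Longrightarrow> lorentz v u = 0"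
proof -
  from len have "\<exists>vs. length vs = m \<and> set vs \<subseteq> spacelike n \<and> sorted_wrt (\<lambda>u v. lorentz u v = 0) vs \<and>
    (\<forall>u \<in> set L. \<forall>v \<in> set vs. lorentz v u = 0)"
  proof (induction m)
    case 0 show ?case by simp
  next
    case (Suc m)
    then obtain vs where vs: "length vs = m" "set vs \<subseteq> spacelike n" "sorted_wrt (\<lambda>u v. lorentz u v = 0) vs"
      "\<forall>u \<in> set L. \<forall>v \<in> set vs. lorentz v u = 0" by auto
    have "set (L @ vs) \<subseteq> carrier_vec (n + 1)" using L vs(2) by (auto simp: spacelike_def)
    moreover have "length (L @ vs) < n + 1" using Suc vs by simp
    ultimately obtain x where x: "x \<in> carrier_vec (n + 1)" "x \<noteq> 0\<^sub>v (n + 1)"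
      "\<And>u. u \<in> set (L @ vs) \<Longrightarrow> lorentz x u = 0" by (rule exists_orthogonal) blast
    have "x \<in> spacelike n" by (rule sp) (use x in auto)
    with x vs show ?case by (intro exI[of _ "x # vs"]) auto
  qed
  then show thesis using that by blast
qed

section \<open>Reflections\<close>

definition reflect :: "real vec \<Rightarrow> real vec \<Rightarrow> real vec" where
  "reflect v x = x - (2 * lorentz x v / lorentz v v) \<cdot>\<^sub>v v"

lemma reflect_carrier:
  "v \<in> carrier_vec (n + 1) \<Longrightarrow> x \<in> carrier_vec (n + 1) \<Longrightarrow> reflect v x \<in> carrier_vec (n + 1)"
  by (auto simp: reflect_def)

lemma reflect_fixes: "v \<in> carrier_vec (n + 1) \<Longrightarrow> x \<in> carrier_vec (n + 1) \<Longrightarrow> lorentz x v = 0 \<Longrightarrow> reflect v x = x"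
  by (auto simp: reflect_def)

lemma reflect_self:
  assumes "v \<in> spacelike n"
  shows "reflect v v = - 1 \<cdot>\<^sub>v v"
  using spacelikeD[OF assms] by (intro eq_vecI) (auto simp: reflect_def)

lemma reflect_add:
  assumes "v \<in> carrier_vec (n + 1)" "x \<in> carrier_vec (n + 1)" "y \<in> carrier_vec (n + 1)"
  shows "reflect v (x + y) = reflect v x + reflect v y"
  using assms by (intro eq_vecI) (auto simp: reflect_def lorentz_linear[of _ n] ring_distribs add_divide_distrib)

lemma reflect_smult:
  assumes "v \<in> carrier_vec (n + 1)" "x \<in> carrier_vec (n + 1)"
  shows "reflect v (a \<cdot>\<^sub>v x) = a \<cdot>\<^sub>v reflect v x"
  using assms by (intro eq_vecI) (auto simp: reflect_def lorentz_linear[of _ n] algebra_simps)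

lemma reflect_lorentz:
  assumes v: "v \<in> spacelike n" and x: "x \<in> carrier_vec (n + 1)" and y: "y \<in> carrier_vec (n + 1)"
  shows "lorentz (reflect v x) (reflect v y) = lorentz x y"
proof -
  note vD = spacelikeD[OF v]
  have "lorentz v y = lorentz y v" using vD y by (simp add: lorentz_comm)
  then show ?thesis
    using vD x y by (simp add: reflect_def lorentz_linear[of _ n])
qed

lemma reflect_reflect:
  assumes v: "v \<in> spacelike n" and x: "x \<in> carrier_vec (n + 1)"
  shows "reflect v (reflect v x) = x"
proof -
  note vD = spacelikeD[OF v]
  have "lorentz (reflect v x) v = - lorentz x v"
    using vD x by (simp add: reflect_def lorentz_linear[of _ n])
  then have "reflect v (reflect v x) = reflect v x - (2 * (- lorentz x v) / lorentz v v) \<cdot>\<^sub>v v"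
    by (simp add: reflect_def[of v "reflect v x"])
  also have "\<dots> = x"
    using vD x by (intro eq_vecI) (auto simp: reflect_def)
  finally show ?thesis .
qed

text \<open>The mirror orthogonal to \<open>x - y\<close> is the bisector of \<open>x\<close> and \<open>y\<close>.\<close>
lemma reflect_swaps:
  assumes x: "x \<in> carrier_vec (n + 1)" and y: "y \<in> carrier_vec (n + 1)"
    and eq: "lorentz x x = lorentz y y" and s: "x - y \<in> spacelike n"
  shows "reflect (x - y) x = y"
proof -
  have yx: "lorentz y x = lorentz x y" using x y by (simp add: lorentz_comm)
  have "lorentz (x - y) (x - y) = 2 * lorentz x (x - y)"
    using x y by (simp add: lorentz_linear[of _ n] yx eq)
  then have "2 * lorentz x (x - y) / lorentz (x - y) (x - y) = 1"
    using spacelikeD(2)[OF s] by simp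
  then have "reflect (x - y) x = x - 1 \<cdot>\<^sub>v (x - y)" unfolding reflect_def by simp
  also have "\<dots> = y" using x y by (intro eq_vecI) auto
  finally show ?thesis .
qed

text \<open>Only the sign of the time coordinate is in question. Were it negative, then the opposite of
  the image would lie on the hyperboloid and have product at most \<open>- 1\<close> with \<open>x\<close>; but the image itself
  has product at most \<open>- 1\<close> with \<open>x\<close>.\<close>
lemma reflect_hyp:
  assumes v: "v \<in> spacelike n" and x: "x \<in> hyp_space n"
  shows "reflect v x \<in> hyp_space n"
proof -
  note vD = spacelikeD[OF v] and xD = hyp_spaceD[OF x]
  let ?y = "reflect v x"
  have y: "?y \<in> carrier_vec (n + 1)" "lorentz ?y ?y = - 1"
    using reflect_carrier[OF vD(1) xD(1)] reflect_lorentz[OF v xD(1) xD(1)] xD by auto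
  have xy: "lorentz x ?y \<le> - 1"
  proof -
    have "lorentz x ?y = - 1 - 2 * (lorentz x v)\<^sup>2 / lorentz v v"
      using vD xD by (simp add: reflect_def lorentz_linear[of _ n] power2_eq_square)
    then show ?thesis using vD by simp
  qed
  have "?y $ 0 \<noteq> 0"
    using lorentz_time_zero(1)[OF y(1)] y(2) by auto
  moreover have "\<not> ?y $ 0 < 0"
  proof
    assume "?y $ 0 < 0"
    then have m: "- 1 \<cdot>\<^sub>v ?y \<in> hyp_space n"
      using y by (auto simp: hyp_space_def lorentz_linear[of _ n])
    have "lorentz x (- 1 \<cdot>\<^sub>v ?y) \<le> - 1" by (rule hyp_lorentz(1)[OF x m])
    then show False using xy xD y by (simp add: lorentz_linear[of _ n])
  qed
  ultimately show ?thesis using y by (simp add: hyp_space_def)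
qed

abbreviation reflects :: "real vec list \<Rightarrow> real vec \<Rightarrow> real vec" where
  "reflects \<equiv> foldr reflect"

lemma reflects_carrier:
  "set vs \<subseteq> spacelike n \<Longrightarrow> x \<in> carrier_vec (n + 1) \<Longrightarrow> reflects vs x \<in> carrier_vec (n + 1)"
proof (induction vs)
  case (Cons v vs)
  then show ?case using reflect_carrier[of v n "reflects vs x"] by (auto dest: spacelikeD)
qed simp

lemma reflects_add:
  "set vs \<subseteq> spacelike n \<Longrightarrow> x \<in> carrier_vec (n + 1) \<Longrightarrow> y \<in> carrier_vec (n + 1) \<Longrightarrow>
    reflects vs (x + y) = reflects vs x + reflects vs y"
proof (induction vs)
  case (Cons v vs)
  then show ?case
    using reflect_add[of v n "reflects vs x" "reflects vs y"] reflects_carrier[of vs n] by (auto dest: spacelikeD)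
qed simp

lemma reflects_smult:
  "set vs \<subseteq> spacelike n \<Longrightarrow> x \<in> carrier_vec (n + 1) \<Longrightarrow> reflects vs (a \<cdot>\<^sub>v x) = a \<cdot>\<^sub>v reflects vs x"
proof (induction vs)
  case (Cons v vs)
  then show ?case
    using reflect_smult[of v n "reflects vs x" a] reflects_carrier[of vs n] by (auto dest: spacelikeD)
qed simp

lemma reflects_lorentz:
  "set vs \<subseteq> spacelike n \<Longrightarrow> x \<in> carrier_vec (n + 1) \<Longrightarrow> y \<in> carrier_vec (n + 1) \<Longrightarrow>
    lorentz (reflects vs x) (reflects vs y) = lorentz x y"
proof (induction vs)
  case (Cons v vs)
  then show ?case
    using reflect_lorentz[of v n "reflects vs x" "reflects vs y"] reflects_carrier[of vs n] by auto
qed simp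

lemma reflects_hyp: "set vs \<subseteq> spacelike n \<Longrightarrow> x \<in> hyp_space n \<Longrightarrow> reflects vs x \<in> hyp_space n"
  by (induction vs) (auto intro: reflect_hyp)

lemma reflects_rev:
  "set vs \<subseteq> spacelike n \<Longrightarrow> x \<in> carrier_vec (n + 1) \<Longrightarrow> reflects (rev vs) (reflects vs x) = x"
proof (induction vs)
  case (Cons v vs)
  then show ?case
    using reflect_reflect[of v n "reflects vs x"] reflects_carrier[of vs n] by auto
qed simp

lemma reflects_fixes:
  "set vs \<subseteq> spacelike n \<Longrightarrow> x \<in> carrier_vec (n + 1) \<Longrightarrow> (\<And>v. v \<in> set vs \<Longrightarrow> lorentz x v = 0) \<Longrightarrow>
    reflects vs x = x"
proof (induction vs)
  case (Cons v vs)
  then show ?case using reflect_fixes[of v n x] by (auto dest: spacelikeD)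
qed simp

text \<open>Agreement of two products of reflections on part of the hyperboloid extends to the linear
  span: \<open>x\<close> is a linear combination of \<open>p\<close> and of a nearby point of the hyperboloid in the plane of \<open>p\<close>
  and \<open>x\<close>. Stated for a single \<open>x\<close>, it applies to the whole space and to any subspace through \<open>p\<close>.\<close>
lemma reflects_eq_near:
  assumes us: "set us \<subseteq> spacelike n" and vs: "set vs \<subseteq> spacelike n"
    and p: "p \<in> hyp_space n" and x: "x \<in> carrier_vec (n + 1)"
    and eqp: "reflects us p = reflects vs p"
    and eq: "\<And>c e. c \<cdot>\<^sub>v (p + e \<cdot>\<^sub>v x) \<in> hyp_space n \<Longrightarrow>
      reflects us (c \<cdot>\<^sub>v (p + e \<cdot>\<^sub>v x)) = reflects vs (c \<cdot>\<^sub>v (p + e \<cdot>\<^sub>v x))"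
  shows "reflects us x = reflects vs x"
proof -
  obtain c e where ce: "c > 0" "e > 0" "c \<cdot>\<^sub>v (p + e \<cdot>\<^sub>v x) \<in> hyp_space n"
    by (rule hyp_perturb[OF p x])
  note pc = hyp_spaceD(1)[OF p]
  have lin: "reflects ws (c \<cdot>\<^sub>v (p + e \<cdot>\<^sub>v x)) = c \<cdot>\<^sub>v (reflects ws p + e \<cdot>\<^sub>v reflects ws x)"
    if "set ws \<subseteq> spacelike n" for ws
    using that pc x by (simp add: reflects_add[of _ n] reflects_smult[of _ n])
  have "c \<cdot>\<^sub>v (reflects vs p + e \<cdot>\<^sub>v reflects us x) = c \<cdot>\<^sub>v (reflects vs p + e \<cdot>\<^sub>v reflects vs x)"
    using eq[OF ce(3)] lin[OF us] lin[OF vs] eqp by simp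
  then have i: "(c \<cdot>\<^sub>v (reflects vs p + e \<cdot>\<^sub>v reflects us x)) $ i =
      (c \<cdot>\<^sub>v (reflects vs p + e \<cdot>\<^sub>v reflects vs x)) $ i" for i
    by simp
  have "reflects us x \<in> carrier_vec (n + 1)" "reflects vs x \<in> carrier_vec (n + 1)" "reflects vs p \<in> carrier_vec (n + 1)"
    using reflects_carrier us vs x pc by blast+
  then have "reflects us x $ i = reflects vs x $ i" if "i < n + 1" for i
    using that ce(1,2) i[of i] by simp
  then show ?thesis
    using reflects_carrier[OF us x] reflects_carrier[OF vs x] by (intro eq_vecI) auto
qed

section \<open>Isometries as products of reflections\<close>

definition mob :: "nat \<Rightarrow> real vec list \<Rightarrow> real vec \<Rightarrow> real vec" where
  "mob n vs = restrict (reflects vs) (hyp_space n)"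

lemma mob_apply [simp]: "x \<in> hyp_space n \<Longrightarrow> mob n vs x = reflects vs x"
  by (simp add: mob_def)

lemma carrier_Mob:
  "carrier (Mob n) = {f \<in> Bij (hyp_space n).
     \<forall>x \<in> hyp_space n. \<forall>y \<in> hyp_space n. hyp_dist (f x) (f y) = hyp_dist x y}"
  by (simp add: Mob_def)

lemma one_Mob: "\<one>\<^bsub>Mob n\<^esub> = mob n []"
  by (auto simp: Mob_def BijGroup_def mob_def)

lemma Mob_closed: "f \<in> carrier (Mob n) \<Longrightarrow> x \<in> hyp_space n \<Longrightarrow> f x \<in> hyp_space n"
  using Bij_imp_funcset by (auto simp: carrier_Mob)

lemma Mob_mult_apply:
  "f \<in> carrier (Mob n) \<Longrightarrow> g \<in> carrier (Mob n) \<Longrightarrow> x \<in> hyp_space n \<Longrightarrow> (f \<otimes>\<^bsub>Mob n\<^esub> g) x = f (g x)"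
  by (simp add: Mob_def BijGroup_def compose_def)

lemma Mob_eqI:
  assumes "f \<in> carrier (Mob n)" "g \<in> carrier (Mob n)" "\<And>x. x \<in> hyp_space n \<Longrightarrow> f x = g x"
  shows "f = g"
  using assms by (intro extensionalityI[of f "hyp_space n"]) (auto simp: carrier_Mob Bij_def)

lemma Mob_lorentz:
  assumes f: "f \<in> carrier (Mob n)" and x: "x \<in> hyp_space n" and y: "y \<in> hyp_space n"
  shows "lorentz (f x) (f y) = lorentz x y"
proof -
  have "arcosh (- lorentz (f x) (f y)) = arcosh (- lorentz x y)"
    using assms by (auto simp: carrier_Mob hyp_dist_def)
  moreover have "- lorentz (f x) (f y) \<ge> 1" "- lorentz x y \<ge> 1"
    using hyp_lorentz(1)[OF Mob_closed[OF f x] Mob_closed[OF f y]] hyp_lorentz(1)[OF x y] by auto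
  ultimately have "- lorentz (f x) (f y) = - lorentz x y"
    by (metis cosh_arcosh_real)
  then show ?thesis by simp
qed

lemma mob_closed:
  assumes vs: "set vs \<subseteq> spacelike n"
  shows "mob n vs \<in> carrier (Mob n)"
proof -
  let ?H = "hyp_space n"
  have rvs: "set (rev vs) \<subseteq> spacelike n" using vs by simp
  have "bij_betw (reflects vs) ?H ?H"
  proof (rule bij_betw_byWitness[of _ "reflects (rev vs)"])
    show "\<forall>x\<in>?H. reflects (rev vs) (reflects vs x) = x"
      using reflects_rev[OF vs] hyp_spaceD(1) by blast
    show "\<forall>x\<in>?H. reflects vs (reflects (rev vs) x) = x"
      using reflects_rev[OF rvs] hyp_spaceD(1) unfolding rev_rev_ident by blast
    show "reflects vs ` ?H \<subseteq> ?H" "reflects (rev vs) ` ?H \<subseteq> ?H"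
      using reflects_hyp[OF vs] reflects_hyp[OF rvs] by blast+
  qed
  then have "bij_betw (mob n vs) ?H ?H"
    by (rule bij_betw_cong[THEN iffD1, rotated]) simp
  then show ?thesis
    using reflects_lorentz[OF vs] hyp_spaceD(1)[of _ n]
    by (auto simp: carrier_Mob Bij_def hyp_dist_def mob_def)
qed

lemma mob_append:
  assumes "set us \<subseteq> spacelike n" "set vs \<subseteq> spacelike n"
  shows "mob n us \<otimes>\<^bsub>Mob n\<^esub> mob n vs = mob n (us @ vs)"
proof (rule Mob_eqI)
  interpret group "Mob n" by (rule Mob_group)
  show "mob n us \<otimes>\<^bsub>Mob n\<^esub> mob n vs \<in> carrier (Mob n)" "mob n (us @ vs) \<in> carrier (Mob n)"
    using assms mob_closed by auto
qed (use assms in \<open>simp add: Mob_mult_apply mob_closed reflects_hyp\<close>)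

text \<open>A basis of \<open>\<real>\<^sup>n\<^sup>+\<^sup>1\<close> consisting of points of the hyperboloid; the coefficient \<open>sqrt 2\<close> gives
  square \<open>1 - 2 = - 1\<close>.\<close>
definition frame :: "nat \<Rightarrow> nat \<Rightarrow> real vec" where
  "frame n i = (if i = 0 then unit_vec (n + 1) 0 else sqrt 2 \<cdot>\<^sub>v unit_vec (n + 1) 0 + unit_vec (n + 1) i)"

lemma lorentz_frame:
  assumes "x \<in> carrier_vec (n + 1)" "i < n + 1"
  shows "lorentz x (frame n i) = (if i = 0 then - x $ 0 else x $ i - sqrt 2 * x $ 0)"
proof -
  have c: "unit_vec (n + 1) j \<in> carrier_vec (n + 1)" "sqrt 2 \<cdot>\<^sub>v unit_vec (n + 1) 0 \<in> carrier_vec (n + 1)" for j :: nat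
    by auto
  show ?thesis
  proof (cases "i = 0")
    case False
    then show ?thesis
      unfolding frame_def
      using assms lorentz_add_right[OF c(2) c(1) assms(1)] lorentz_smult_right[OF c(1) assms(1)]
        lorentz_unit_0[OF assms(1)] lorentz_unit_pos[OF assms(1)]
      by simp
  qed (use assms lorentz_unit_0[OF assms(1)] in \<open>simp add: frame_def\<close>)
qed

lemma frame_hyp:
  assumes "i < n + 1"
  shows "frame n i \<in> hyp_space n"
proof -
  have c: "frame n i \<in> carrier_vec (n + 1)" by (auto simp: frame_def)
  have v: "frame n i $ 0 = (if i = 0 then 1 else sqrt 2)" "i \<noteq> 0 \<Longrightarrow> frame n i $ i = 1"
    using assms by (auto simp: frame_def)
  show ?thesis
    using c v lorentz_frame[OF c assms] by (auto simp: hyp_space_def)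
qed

lemma frame_determines:
  assumes x: "x \<in> carrier_vec (n + 1)" and o: "\<And>i. i < n + 1 \<Longrightarrow> lorentz x (frame n i) = 0"
  shows "x = 0\<^sub>v (n + 1)"
proof (rule eq_vecI)
  have 0: "x $ 0 = 0" using lorentz_frame[OF x, of 0] o[of 0] by simp
  show "x $ i = 0\<^sub>v (n + 1) $ i" if "i < dim_vec (0\<^sub>v (n + 1))" for i
    using that lorentz_frame[OF x, of i] o[of i] 0 by (cases "i = 0") auto
qed (use x in auto)

text \<open>After the first \<open>i\<close> frame points are fixed, the reflection exchanging frame point \<open>i\<close> and its
  image fixes the earlier frame points, because they have the same distance to both. An isometry that
  fixes the whole frame preserves the products of every point with a basis, so it is the identity. The
  argument uses distances only; that isometries are linear is a consequence.\<close>
theorem Mob_reflections: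
  assumes f: "f \<in> carrier (Mob n)"
  obtains vs where "set vs \<subseteq> spacelike n" "length vs \<le> n + 1" "f = mob n vs"
proof -
  have "\<exists>vs. set vs \<subseteq> spacelike n \<and> length vs \<le> i \<and> (\<forall>j<i. reflects vs (f (frame n j)) = frame n j)"
    if "i \<le> n + 1" for i
    using that
  proof (induction i)
    case 0
    show ?case by (intro exI[of _ "[]"]) simp
  next
    case (Suc i)
    then obtain vs where vs: "set vs \<subseteq> spacelike n" "length vs \<le> i"
      "\<And>j. j < i \<Longrightarrow> reflects vs (f (frame n j)) = frame n j" by auto
    define h where "h x = reflects vs (f x)" for x
    have h: "h x \<in> hyp_space n" if "x \<in> hyp_space n" for x
      unfolding h_def using that reflects_hyp[OF vs(1)] Mob_closed[OF f] by blast
    have hl: "lorentz (h x) (h y) = lorentz x y" if "x \<in> hyp_space n" "y \<in> hyp_space n" for x y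
      unfolding h_def using that reflects_lorentz[OF vs(1)] Mob_closed[OF f] Mob_lorentz[OF f] hyp_spaceD(1)
      by metis
    have i: "i < n + 1" using Suc by simp
    note fi = frame_hyp[OF i]
    show ?case
    proof (cases "h (frame n i) = frame n i")
      case True
      with vs show ?thesis by (intro exI[of _ vs]) (auto simp: h_def less_Suc_eq)
    next
      case False
      define v where "v = h (frame n i) - frame n i"
      have v: "v \<in> spacelike n" unfolding v_def by (rule hyp_diff_spacelike) (use False h fi in auto)
      have "reflect v (h (frame n i)) = frame n i"
        unfolding v_def using hyp_spaceD[OF h[OF fi]] hyp_spaceD[OF fi] v
        by (intro reflect_swaps[of _ n]) (auto simp: v_def)
      moreover have "reflect v (h (frame n j)) = frame n j" if j: "j < i" for j
      proof -
        have fj: "frame n j \<in> hyp_space n" using frame_hyp j i by simp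
        have e: "h (frame n j) = frame n j" using vs(3)[OF j] by (simp add: h_def)
        have "lorentz v (frame n j) = lorentz (h (frame n i)) (h (frame n j)) - lorentz (frame n i) (frame n j)"
          unfolding v_def e by (rule lorentz_diff_left) (rule hyp_spaceD(1)[OF h[OF fi]], rule hyp_spaceD(1)[OF fi])
        also have "\<dots> = 0" using hl[OF fi fj] by simp
        finally have "lorentz (frame n j) v = 0"
          using spacelikeD(1)[OF v] hyp_spaceD(1)[OF fj] by (simp add: lorentz_comm)
        then show ?thesis
          unfolding e using reflect_fixes spacelikeD(1)[OF v] hyp_spaceD(1)[OF fj] by blast
      qed
      ultimately show ?thesis
        using vs v by (intro exI[of _ "v # vs"]) (auto simp: h_def less_Suc_eq)
    qed
  qed
  from this[of "n + 1"] obtain vs where vs: "set vs \<subseteq> spacelike n" "length vs \<le> n + 1"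
    "\<And>j. j < n + 1 \<Longrightarrow> reflects vs (f (frame n j)) = frame n j" by auto
  have id: "reflects vs (f x) = x" if x: "x \<in> hyp_space n" for x
  proof -
    let ?z = "reflects vs (f x)"
    have z: "?z \<in> hyp_space n" using reflects_hyp[OF vs(1)] Mob_closed[OF f x] by blast
    have "lorentz (?z - x) (frame n j) = 0" if j: "j < n + 1" for j
    proof -
      note fj = frame_hyp[OF j]
      have "lorentz ?z (reflects vs (f (frame n j))) = lorentz x (frame n j)"
        using reflects_lorentz[OF vs(1)] Mob_closed[OF f] Mob_lorentz[OF f] hyp_spaceD(1) x fj by metis
      then show ?thesis
        using vs(3)[OF j] lorentz_diff_left[OF hyp_spaceD(1)[OF z] hyp_spaceD(1)[OF x]] by simp
    qed
    then have "?z - x = 0\<^sub>v (n + 1)"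
      using z x by (intro frame_determines) (auto dest!: hyp_spaceD(1))
    then have "(?z - x) $ i = 0" if "i < n + 1" for i using that by simp
    then show ?thesis
      using hyp_spaceD(1)[OF z] hyp_spaceD(1)[OF x] by (intro eq_vecI) auto
  qed
  have "f = mob n (rev vs)"
  proof (rule Mob_eqI[OF f])
    show "mob n (rev vs) \<in> carrier (Mob n)" using vs mob_closed by simp
    show "f x = mob n (rev vs) x" if x: "x \<in> hyp_space n" for x
      using id[OF x] reflects_rev[OF vs(1) hyp_spaceD(1)[OF Mob_closed[OF f x]]] x by simp
  qed
  with vs that[of "rev vs"] show thesis by simp
qed

section \<open>Orientation\<close>

definition reflect_mat :: "nat \<Rightarrow> real vec \<Rightarrow> real mat" where
  "reflect_mat n v = mat_of_cols (n + 1) (map (\<lambda>i. reflect v (unit_vec (n + 1) i)) [0..<n + 1])"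

lemma reflect_mat_carrier: "reflect_mat n v \<in> carrier_mat (n + 1) (n + 1)"
  by (auto simp: reflect_mat_def)

lemma reflect_mat_index:
  assumes v: "v \<in> carrier_vec (n + 1)" and "i < n + 1" "j < n + 1"
  shows "reflect_mat n v $$ (i, j) =
    (if i = j then 1 else 0) - 2 / lorentz v v * v $ i * (if j = 0 then - v $ 0 else v $ j)"
proof -
  have "lorentz (unit_vec (n + 1) j) v = lorentz v (unit_vec (n + 1) j)"
    by (rule lorentz_comm) (use v in simp)
  also have "\<dots> = (if j = 0 then - v $ 0 else v $ j)"
    using lorentz_unit_0[OF v] lorentz_unit_pos[OF v, of j] assms by simp
  finally have "lorentz (unit_vec (n + 1) j) v = (if j = 0 then - v $ 0 else v $ j)" .
  then show ?thesis
    using assms by (simp add: reflect_mat_def mat_of_cols_index reflect_def nth_append del: upt_Suc)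
qed

lemma reflect_mat_mult:
  assumes v: "v \<in> carrier_vec (n + 1)" and x: "x \<in> carrier_vec (n + 1)"
  shows "reflect_mat n v *\<^sub>v x = reflect v x"
proof (rule eq_vecI)
  fix i assume "i < dim_vec (reflect v x)"
  then have i: "i < n + 1" using v by (simp add: reflect_def)
  have "(reflect_mat n v *\<^sub>v x) $ i = (\<Sum>j = 0..<n + 1. reflect_mat n v $$ (i, j) * x $ j)"
    using i x reflect_mat_carrier[of n v] by (simp add: scalar_prod_def del: sum.op_ivl_Suc)
  also have "\<dots> = (\<Sum>j = 0..<n + 1. (if i = j then x $ j else 0)
      - 2 / lorentz v v * v $ i * ((if j = 0 then - v $ 0 else v $ j) * x $ j))"
    using i v by (intro sum.cong) (auto simp: reflect_mat_index algebra_simps)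
  also have "\<dots> = x $ i - 2 / lorentz v v * v $ i * (\<Sum>j = 0..<n + 1. (if j = 0 then - v $ 0 else v $ j) * x $ j)"
    using i by (simp add: sum_subtractf sum_distrib_left del: sum.op_ivl_Suc)
  also have "(\<Sum>j = 0..<n + 1. (if j = 0 then - v $ 0 else v $ j) * x $ j) = lorentz x v"
    using x by (subst sum.atLeast_Suc_lessThan) (simp_all add: lorentz_def mult.commute del: sum.op_ivl_Suc)
  finally show "(reflect_mat n v *\<^sub>v x) $ i = reflect v x $ i"
    using i v x by (simp add: reflect_def)
qed (use v reflect_mat_carrier[of n v] in \<open>simp add: reflect_def\<close>)

lemma mat_eq_by_vec:
  assumes A: "A \<in> carrier_mat m m" and B: "B \<in> carrier_mat m m"
    and eq: "\<And>x. x \<in> carrier_vec m \<Longrightarrow> A *\<^sub>v x = B *\<^sub>v (x :: real vec)"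
  shows "A = B"
proof (rule eq_matI)
  fix i j assume "i < dim_row B" "j < dim_col B"
  then have ij: "i < m" "j < m" using B by auto
  have "(A *\<^sub>v unit_vec m j) $ i = (B *\<^sub>v unit_vec m j) $ i" using eq by simp
  then show "A $$ (i, j) = B $$ (i, j)" using ij A B by simp
qed (use A B in auto)

lemma det_reflect_mat_axis:
  assumes "1 \<le> n"
  shows "det (reflect_mat n (unit_vec (n + 1) 1)) = - 1"
proof -
  have "lorentz (unit_vec (n + 1) 1) (unit_vec (n + 1) 1) = 1"
    using assms lorentz_unit_pos[of "unit_vec (n + 1) 1" n 1] by simp
  then have "reflect_mat n (unit_vec (n + 1) 1) = multrow_mat (n + 1) 1 (- 1)"
    using assms reflect_mat_carrier[of n "unit_vec (n + 1) 1"]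
    by (intro eq_matI) (auto simp: reflect_mat_index unit_vec_def)
  then show ?thesis using assms by (simp add: det_multrow_mat)
qed

text \<open>Conjugation by a Lorentz isometry, here a reflection, carries the reflection in \<open>v\<close> to the
  reflection in the image of \<open>v\<close>.\<close>
lemma reflect_conjugate:
  assumes w: "w \<in> spacelike n" and v: "v \<in> spacelike n" and x: "x \<in> carrier_vec (n + 1)"
  shows "reflect w (reflect v (reflect w x)) = reflect (reflect w v) x"
proof -
  note vD = spacelikeD[OF v] and wD = spacelikeD[OF w]
  have wx: "reflect w x \<in> carrier_vec (n + 1)" and wv: "reflect w v \<in> carrier_vec (n + 1)"
    using reflect_carrier[OF wD(1)] x vD by auto
  have l: "lorentz (reflect w x) v = lorentz x (reflect w v)"
    using reflect_lorentz[OF w wx vD(1)] reflect_reflect[OF w x] by simp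
  define c where "c = 2 * lorentz x (reflect w v) / lorentz v v"
  have "reflect v (reflect w x) = reflect w x + (- c) \<cdot>\<^sub>v v"
    unfolding c_def reflect_def[of v] l using wx vD by (intro eq_vecI) auto
  then have "reflect w (reflect v (reflect w x)) = reflect w (reflect w x) + (- c) \<cdot>\<^sub>v reflect w v"
    using reflect_add[OF wD(1) wx, of "(- c) \<cdot>\<^sub>v v"] reflect_smult[OF wD(1) vD(1), of "- c"] vD by simp
  also have "\<dots> = x + (- c) \<cdot>\<^sub>v reflect w v" using reflect_reflect[OF w x] by simp
  also have "\<dots> = reflect (reflect w v) x"
    unfolding reflect_def[of "reflect w v"] c_def reflect_lorentz[OF w vD(1) vD(1)]
    using x wv by (intro eq_vecI) auto
  finally show ?thesis .
qed

lemma reflect_scaled: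
  assumes "t \<noteq> 0" "v \<in> carrier_vec (n + 1)" "x \<in> carrier_vec (n + 1)"
  shows "reflect (t \<cdot>\<^sub>v v) x = reflect v x"
  unfolding reflect_def using assms by (intro eq_vecI) (auto simp: lorentz_linear[of _ n])

text \<open>A suitable reflection carries \<open>v\<close> to a multiple of a coordinate axis. Conjugation does not
  change the determinant, and for the axis the matrix is diagonal.\<close>
lemma det_reflect_mat:
  assumes n: "1 \<le> n" and v: "v \<in> spacelike n"
  shows "det (reflect_mat n v) = - 1"
proof -
  note vD = spacelikeD[OF v]
  let ?N = "n + 1"
  let ?e = "unit_vec ?N 1 :: real vec"
  \<comment> \<open>The sign of t makes v - t e spacelike, where e is the first spatial axis.\<close>
  define t where "t = (if v $ 1 \<le> 0 then 1 else - 1) * sqrt (lorentz v v)"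
  have tt: "t * t = lorentz v v" "t \<noteq> 0" using vD by (auto simp: t_def)
  have tv: "t * v $ 1 \<le> 0" using vD by (auto simp: t_def mult_le_0_iff)
  define w where "w = v - t \<cdot>\<^sub>v ?e"
  have e: "?e \<in> carrier_vec ?N" by simp
  have te: "t \<cdot>\<^sub>v ?e \<in> carrier_vec ?N" by simp
  have wc: "w \<in> carrier_vec ?N" unfolding w_def using vD te by simp
  have ve: "lorentz v ?e = v $ 1" using lorentz_unit_pos[OF vD(1), of 1] n by simp
  have ee: "lorentz ?e ?e = 1" using lorentz_unit_pos[OF e, of 1] n by simp
  have "lorentz ?e v = lorentz v ?e" by (rule lorentz_comm) (use vD in simp)
  then have ev: "lorentz ?e v = v $ 1" using ve by simp
  have tete: "lorentz (t \<cdot>\<^sub>v ?e) (t \<cdot>\<^sub>v ?e) = lorentz v v"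
    using lorentz_smult_left[OF e, of t "t \<cdot>\<^sub>v ?e"] lorentz_smult_right[OF e e, of t] ee tt by simp
  have "lorentz w w = 2 * lorentz v v - 2 * (t * v $ 1)"
    unfolding w_def
    using lorentz_diff_left[OF vD(1) te, of "v - t \<cdot>\<^sub>v ?e"] lorentz_diff_right[OF vD(1) te vD(1)]
      lorentz_diff_right[OF vD(1) te te] lorentz_smult_left[OF e, of t v] lorentz_smult_right[OF e vD(1), of t]
      tete ve ev by simp
  then have w: "w \<in> spacelike n" using wc tv vD by (simp add: spacelike_def)
  have wv: "reflect w v = t \<cdot>\<^sub>v ?e"
    unfolding w_def using reflect_swaps[OF vD(1) te tete[symmetric]] w by (simp add: w_def)
  let ?R = "reflect_mat n"
  have c: "?R u \<in> carrier_mat ?N ?N" for u by (rule reflect_mat_carrier)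
  have "?R w * ?R v * ?R w = ?R ?e"
  proof (rule mat_eq_by_vec)
    fix x :: "real vec" assume x: "x \<in> carrier_vec ?N"
    note cc = reflect_carrier[OF wc x] reflect_carrier[OF vD(1) reflect_carrier[OF wc x]]
    have "?R w * ?R v * ?R w *\<^sub>v x = ?R w *\<^sub>v (?R v *\<^sub>v (?R w *\<^sub>v x))"
      unfolding assoc_mult_mat_vec[OF mult_carrier_mat[OF c[of w] c[of v]] c[of w] x]
      by (rule assoc_mult_mat_vec[OF c c mult_mat_vec_carrier[OF c x]])
    also have "\<dots> = reflect w (reflect v (reflect w x))"
      using reflect_mat_mult[OF wc x] reflect_mat_mult[OF vD(1) cc(1)] reflect_mat_mult[OF wc cc(2)] by simp
    also have "\<dots> = reflect ?e x"
      using reflect_conjugate[OF w v x] reflect_scaled[OF tt(2) e x] wv by simp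
    also have "\<dots> = ?R ?e *\<^sub>v x" using reflect_mat_mult[OF e x] by simp
    finally show "?R w * ?R v * ?R w *\<^sub>v x = ?R ?e *\<^sub>v x" .
  qed (rule mult_carrier_mat[OF mult_carrier_mat[OF c c] c], rule c)
  then have "det (?R w) * det (?R v) * det (?R w) = - 1"
    using det_mult[OF mult_carrier_mat[OF c[of w] c[of v]] c[of w]] det_mult[OF c[of w] c[of v]] det_reflect_mat_axis[OF n] by simp
  moreover have "det (?R w) * det (?R w) = 1"
  proof -
    have "?R w * ?R w = 1\<^sub>m ?N"
    proof (rule mat_eq_by_vec)
      fix x :: "real vec" assume x: "x \<in> carrier_vec ?N"
      show "?R w * ?R w *\<^sub>v x = 1\<^sub>m ?N *\<^sub>v x"
        using assoc_mult_mat_vec[OF c[of w] c[of w] x] reflect_mat_mult[OF wc x]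
          reflect_mat_mult[OF wc reflect_carrier[OF wc x]] reflect_reflect[OF w x] x by simp
    qed (rule mult_carrier_mat[OF c c], rule one_carrier_mat)
    then show ?thesis using det_mult[OF c[of w] c[of w]] by simp
  qed
  ultimately show ?thesis by (simp add: mult.commute mult.left_commute)
qed

lemma det_map_reflect:
  assumes n: "1 \<le> n" and v: "v \<in> spacelike n" and X: "X \<in> carrier_mat (n + 1) (n + 1)"
  shows "det (mat_of_cols (n + 1) (map (reflect v) (cols X))) = - det X"
proof -
  note vD = spacelikeD[OF v]
  let ?M = "mat_of_cols (n + 1) (map (reflect v) (cols X))"
  have "?M = reflect_mat n v * X"
  proof (rule eq_matI)
    show "dim_row ?M = dim_row (reflect_mat n v * X)" "dim_col ?M = dim_col (reflect_mat n v * X)"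
      using X reflect_mat_carrier[of n v] by auto
    fix i j assume "i < dim_row (reflect_mat n v * X)" "j < dim_col (reflect_mat n v * X)"
    then have ij: "i < n + 1" "j < n + 1" using X reflect_mat_carrier[of n v] by auto
    have "?M $$ (i, j) = reflect v (col X j) $ i"
      using ij X by (simp add: mat_of_cols_index)
    also have "\<dots> = (reflect_mat n v *\<^sub>v col X j) $ i"
      using reflect_mat_mult[OF vD(1), of "col X j"] X ij by simp
    also have "\<dots> = (reflect_mat n v * X) $$ (i, j)"
      using ij X reflect_mat_carrier[of n v] by simp
    finally show "?M $$ (i, j) = (reflect_mat n v * X) $$ (i, j)" .
  qed
  then show ?thesis using det_mult[OF reflect_mat_carrier X] det_reflect_mat[OF n v] by simp
qed

lemma det_map_reflects:
  assumes n: "1 \<le> n" and vs: "set vs \<subseteq> spacelike n" and X: "X \<in> carrier_mat (n + 1) (n + 1)"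
  shows "det (mat_of_cols (n + 1) (map (reflects vs) (cols X))) = (- 1) ^ length vs * det X"
  using vs
proof (induction vs)
  case Nil
  have "mat_of_cols (n + 1) (map (\<lambda>x. x) (cols X)) = X" using X mat_of_cols_cols[of X] by auto
  then show ?case by (simp add: id_def)
next
  case (Cons v vs)
  let ?Y = "mat_of_cols (n + 1) (map (reflects vs) (cols X))"
  have cX: "x \<in> carrier_vec (n + 1)" if "x \<in> set (cols X)" for x
    using that X cols_dim[of X] by auto
  have Y: "?Y \<in> carrier_mat (n + 1) (n + 1)" using X by (metis cols_length carrier_matD(2) length_map mat_of_cols_carrier(1))
  have "cols ?Y = map (reflects vs) (cols X)"
    by (rule cols_mat_of_cols) (use cX Cons.prems reflects_carrier in auto)
  then have "det (mat_of_cols (n + 1) (map (reflect v) (map (reflects vs) (cols X)))) = - det ?Y"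
    using det_map_reflect[OF n _ Y, of v] Cons.prems by auto
  then show ?case using Cons by (simp add: comp_def)
qed

definition frame_mat :: "nat \<Rightarrow> real mat" where
  "frame_mat n = mat_of_cols (n + 1) (map (frame n) [0..<n + 1])"

lemma det_frame_mat: "det (frame_mat n) = 1"
proof -
  have c: "frame_mat n \<in> carrier_mat (n + 1) (n + 1)" by (auto simp: frame_mat_def)
  have ind: "frame_mat n $$ (i, j) = frame n j $ i" if "i < n + 1" "j < n + 1" for i j
    using that by (simp add: frame_mat_def mat_of_cols_index del: upt_Suc)
  have "upper_triangular (frame_mat n)"
    using c by (intro upper_triangularI) (auto simp: ind frame_def)
  then have "det (frame_mat n) = prod_list (diag_mat (frame_mat n))"
    by (rule det_upper_triangular[OF _ c])
  also have "diag_mat (frame_mat n) = map (\<lambda>i. 1) [0..<n + 1]"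
    using c unfolding diag_mat_def by (intro map_cong) (auto simp: ind frame_def)
  also have "prod_list \<dots> = 1" by (simp add: map_replicate_const del: upt_Suc)
  finally show ?thesis .
qed

text \<open>One positively oriented simplex suffices for the forward direction; the frame is one, as its
  matrix is triangular with unit diagonal.\<close>
lemma orientation_preserving_mob:
  assumes n: "1 \<le> n" and vs: "set vs \<subseteq> spacelike n"
  shows "orientation_preserving n (mob n vs) \<longleftrightarrow> even (length vs)"
proof -
  have eq: "det (mat_of_cols (n + 1) (map (mob n vs) (cols X))) = (- 1) ^ length vs * det X"
    if X: "X \<in> carrier_mat (n + 1) (n + 1)" "set (cols X) \<subseteq> hyp_space n" for X
  proof -
    have e: "map (mob n vs) (cols X) = map (reflects vs) (cols X)" using X by auto
    show ?thesis unfolding e by (rule det_map_reflects[OF n vs X(1)])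
  qed
  have F: "frame_mat n \<in> carrier_mat (n + 1) (n + 1)" "set (cols (frame_mat n)) \<subseteq> hyp_space n"
  proof -
    show "frame_mat n \<in> carrier_mat (n + 1) (n + 1)" by (auto simp: frame_mat_def)
    have "cols (frame_mat n) = map (frame n) [0..<n + 1]"
      unfolding frame_mat_def by (rule cols_mat_of_cols) (use frame_hyp hyp_spaceD in auto)
    then show "set (cols (frame_mat n)) \<subseteq> hyp_space n" using frame_hyp by auto
  qed
  show ?thesis
  proof
    assume "orientation_preserving n (mob n vs)"
    then have "det (mat_of_cols (n + 1) (map (mob n vs) (cols (frame_mat n)))) > 0"
      using F det_frame_mat unfolding orientation_preserving_def by auto
    then have "(- 1 :: real) ^ length vs > 0" unfolding eq[OF F] by (simp add: det_frame_mat)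
    then show "even (length vs)" by (cases "even (length vs)") auto
  qed (use eq in \<open>auto simp: orientation_preserving_def\<close>)
qed

section \<open>Involutions as products of orthogonal reflections\<close>

text \<open>Orthogonality is symmetric, so it is enough to ask it for each pair in list order. The list
  form supports induction from the head. On spacelike lists it also excludes repetitions.\<close>
abbreviation orthogonal :: "real vec list \<Rightarrow> bool" where
  "orthogonal \<equiv> sorted_wrt (\<lambda>u v. lorentz u v = 0)"

lemma reflects_commute:
  assumes v: "v \<in> spacelike n" and vs: "set vs \<subseteq> spacelike n" and y: "y \<in> carrier_vec (n + 1)"
    and o: "\<And>u. u \<in> set vs \<Longrightarrow> lorentz v u = 0"
  shows "reflects vs (reflect v y) = reflect v (reflects vs y)"
proof -
  note vD = spacelikeD[OF v]
  have Rv: "reflects vs v = v" using reflects_fixes[OF vs vD(1)] o by blast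
  have Ry: "reflects vs y \<in> carrier_vec (n + 1)" by (rule reflects_carrier[OF vs y])
  define c where "c = 2 * lorentz y v / lorentz v v"
  have cv: "- c \<cdot>\<^sub>v v \<in> carrier_vec (n + 1)" using vD by simp
  have l: "lorentz (reflects vs y) v = lorentz y v"
    using reflects_lorentz[OF vs y vD(1)] Rv by simp
  have "reflect v y = y + (- c) \<cdot>\<^sub>v v"
    unfolding reflect_def c_def using y vD by (intro eq_vecI) auto
  then have "reflects vs (reflect v y) = reflects vs y + (- c) \<cdot>\<^sub>v v"
    using reflects_add[OF vs y cv] reflects_smult[OF vs vD(1), of "- c"] Rv by simp
  also have "\<dots> = reflect v (reflects vs y)"
    unfolding reflect_def l c_def using Ry vD by (intro eq_vecI) auto
  finally show ?thesis .
qed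

lemma reflects_involution:
  "set vs \<subseteq> spacelike n \<Longrightarrow> orthogonal vs \<Longrightarrow> x \<in> carrier_vec (n + 1) \<Longrightarrow>
    reflects vs (reflects vs x) = x"
proof (induction vs)
  case (Cons v vs)
  have v: "v \<in> spacelike n" and vs: "set vs \<subseteq> spacelike n" using Cons.prems by auto
  have c: "reflects vs x \<in> carrier_vec (n + 1)" by (rule reflects_carrier[OF vs Cons.prems(3)])
  have "reflects vs (reflect v (reflects vs x)) = reflect v (reflects vs (reflects vs x))"
    using Cons.prems by (intro reflects_commute[OF v vs c]) auto
  also have "\<dots> = reflect v x" using Cons by simp
  finally show ?case using reflect_reflect[OF v Cons.prems(3)] by simp
qed simp

text \<open>The first vector \<open>v\<close> is fixed by the remaining reflections, hence \<open>x\<close> keeps its product with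
  \<open>v\<close> under them and changes its sign under the reflection in \<open>v\<close>. A fixed \<open>x\<close> is thus orthogonal to
  \<open>v\<close>, and the induction continues with the remaining reflections.\<close>
lemma reflects_fixed_iff:
  "set vs \<subseteq> spacelike n \<Longrightarrow> orthogonal vs \<Longrightarrow> x \<in> carrier_vec (n + 1) \<Longrightarrow>
    reflects vs x = x \<longleftrightarrow> (\<forall>v \<in> set vs. lorentz x v = 0)"
proof (induction vs)
  case (Cons v vs)
  have v: "v \<in> spacelike n" and vs: "set vs \<subseteq> spacelike n" using Cons.prems by auto
  note vD = spacelikeD[OF v]
  let ?y = "reflects vs x"
  have y: "?y \<in> carrier_vec (n + 1)" by (rule reflects_carrier[OF vs Cons.prems(3)])
  have IH: "?y = x \<longleftrightarrow> (\<forall>v \<in> set vs. lorentz x v = 0)" using Cons by simp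
  have "reflects vs v = v" using Cons.prems by (intro reflects_fixes[OF vs vD(1)]) auto
  then have yv: "lorentz ?y v = lorentz x v"
    using reflects_lorentz[OF vs Cons.prems(3) vD(1)] by simp
  show ?case
  proof
    assume "reflects (v # vs) x = x"
    then have e: "reflect v ?y = x" by simp
    have "lorentz x (- 1 \<cdot>\<^sub>v v) = lorentz ?y v"
      using reflect_lorentz[OF v y vD(1)] unfolding reflect_self[OF v] e .
    then have "lorentz x v = 0"
      using yv lorentz_smult_right[OF vD(1) Cons.prems(3), of "- 1"] by simp
    moreover from this have "?y = x"
      using reflect_fixes[OF vD(1) y] yv e by simp
    ultimately show "\<forall>u \<in> set (v # vs). lorentz x u = 0" using IH by simp
  next
    assume "\<forall>u \<in> set (v # vs). lorentz x u = 0"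
    then show "reflects (v # vs) x = x" by (intro reflects_fixes[OF Cons.prems(1,3)]) auto
  qed
qed simp

context
  fixes n :: nat
begin

interpretation VS: vec_space "TYPE(real)" "n + 1" .

lemma span_orthogonal:
  assumes B: "B \<subseteq> carrier_vec (n + 1)" and w: "w \<in> carrier_vec (n + 1)"
    and o: "\<And>b. b \<in> B \<Longrightarrow> lorentz b w = 0" and x: "x \<in> VS.span B"
  shows "lorentz x w = 0"
proof -
  obtain a A where A: "x = VS.lincomb a A" "finite A" "A \<subseteq> B" using VS.in_spanE[OF x] by blast
  have "VS.lincomb a A \<in> carrier_vec (n + 1) \<and> lorentz (VS.lincomb a A) w = 0"
    using A(2,3)
  proof (induction A)
    case empty
    have "VS.lincomb a {} = 0\<^sub>v (n + 1)" unfolding VS.lincomb_def by (rule VS.M.finsum_empty)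
    then show ?case by (simp add: lorentz_def)
  next
    case (insert b A)
    have bc: "b \<in> carrier_vec (n + 1)" "A \<subseteq> carrier_vec (n + 1)" using insert B by auto
    have "VS.lincomb a (insert b A) = a b \<cdot>\<^sub>v b + VS.lincomb a A"
      using insert(1,2) bc unfolding VS.lincomb_def by (subst VS.M.finsum_insert) auto
    moreover have "lorentz (a b \<cdot>\<^sub>v b) w = 0"
      using lorentz_smult_left[OF bc(1)] o insert.prems by simp
    moreover have "a b \<cdot>\<^sub>v b \<in> carrier_vec (n + 1)" using bc by simp
    moreover have "VS.lincomb a A \<in> carrier_vec (n + 1)" "lorentz (VS.lincomb a A) w = 0" using insert by auto
    ultimately show ?case using lorentz_add_left[of "a b \<cdot>\<^sub>v b" n "VS.lincomb a A" w] by simp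
  qed
  then show ?thesis using A(1) by simp
qed

text \<open>The span of \<open>B\<close> is orthogonal to \<open>w\<close>, but \<open>w\<close> is not orthogonal to itself.\<close>
lemma lin_indpt_insert_orthogonal:
  assumes B: "B \<subseteq> carrier_vec (n + 1)" "VS.lin_indpt B" and w: "w \<in> carrier_vec (n + 1)"
    and o: "\<And>b. b \<in> B \<Longrightarrow> lorentz b w = 0" and nn: "lorentz w w \<noteq> 0"
  shows "VS.lin_indpt (insert w B)" "w \<notin> B"
proof -
  show wB: "w \<notin> B" using o nn by blast
  have "w \<notin> VS.span B" using span_orthogonal[OF B(1) w o] nn by blast
  then show "VS.lin_indpt (insert w B)"
    using VS.lin_dep_iff_in_span[OF _ B(2), of w] B(1) w wB by simp
qed

lemma lin_indpt_union_orthogonal: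
  "set vs \<subseteq> spacelike n \<Longrightarrow> orthogonal vs \<Longrightarrow> B \<subseteq> carrier_vec (n + 1) \<Longrightarrow> VS.lin_indpt B \<Longrightarrow> finite B \<Longrightarrow>
    (\<And>b v. b \<in> B \<Longrightarrow> v \<in> set vs \<Longrightarrow> lorentz v b = 0) \<Longrightarrow>
    VS.lin_indpt (B \<union> set vs) \<and> card (B \<union> set vs) = card B + length vs"
proof (induction vs)
  case (Cons v vs)
  have v: "v \<in> carrier_vec (n + 1)" "lorentz v v \<noteq> 0" using Cons.prems spacelikeD[of v n] by auto
  have c: "b \<in> carrier_vec (n + 1)" if "b \<in> B \<union> set vs" for b
    using that Cons.prems spacelikeD by auto
  have IH: "VS.lin_indpt (B \<union> set vs)" "card (B \<union> set vs) = card B + length vs"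
    using Cons by auto
  have o: "lorentz b v = 0" if "b \<in> B \<union> set vs" for b
  proof -
    have "lorentz v b = 0" using that Cons.prems by auto
    then show ?thesis using c[OF that] v by (simp add: lorentz_comm)
  qed
  have "VS.lin_indpt (insert v (B \<union> set vs))" "v \<notin> B \<union> set vs"
    using lin_indpt_insert_orthogonal[OF _ IH(1) v(1) o v(2)] c by blast+
  then show ?case using IH(2) Cons.prems by simp
qed simp

text \<open>Otherwise \<open>B\<close>, \<open>x\<close> and \<open>vs\<close> together would be \<open>n + 2\<close> independent vectors.\<close>
lemma span_orthogonal_complement:
  assumes vs: "set vs \<subseteq> spacelike n" "orthogonal vs"
    and B: "B \<subseteq> carrier_vec (n + 1)" "VS.lin_indpt B" "finite B" "card B + length vs = n + 1"
    and o: "\<And>b v. b \<in> B \<Longrightarrow> v \<in> set vs \<Longrightarrow> lorentz v b = 0"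
    and x: "x \<in> carrier_vec (n + 1)" "\<And>v. v \<in> set vs \<Longrightarrow> lorentz v x = 0"
  shows "x \<in> VS.span B"
proof (rule ccontr)
  assume nx: "x \<notin> VS.span B"
  then have xB: "x \<notin> B" using B(1) VS.in_own_span by auto
  with nx have "VS.lin_indpt (insert x B)"
    using VS.lin_dep_iff_in_span[OF _ B(2), of x] B(1) x(1) by simp
  then have li: "VS.lin_indpt (insert x B \<union> set vs)" "card (insert x B \<union> set vs) = card (insert x B) + length vs"
    using lin_indpt_union_orthogonal[OF vs, of "insert x B"] B x o by auto
  have "insert x B \<union> set vs \<subseteq> carrier_vec (n + 1)" using B(1) x(1) vs(1) spacelikeD by auto
  then have "card (insert x B \<union> set vs) \<le> n + 1"
    using VS.li_le_dim(2)[OF VS.fin_dim _ li(1)] unfolding VS.dim_is_n by blast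
  then show False using li(2) xB B(3,4) by simp
qed

text \<open>The fixed points are the points of the hyperboloid orthogonal to \<open>vs\<close>. Such a point \<open>p\<close> exists
  as the midpoint of a point and its image, and \<open>p\<close> with an orthogonal system of \<open>n - k\<close> spacelike
  vectors orthogonal to \<open>p\<close> and \<open>vs\<close> is a basis of the fixed subspace.\<close>
lemma k_involution_mob:
  assumes vs: "set vs \<subseteq> spacelike n" "orthogonal vs" and k: "length vs = k" "1 \<le> k" "k \<le> n"
  shows "mob n vs \<in> k_involutions k n"
proof -
  interpret G: group "Mob n" by (rule Mob_group)
  have f: "mob n vs \<in> carrier (Mob n)" by (rule mob_closed[OF vs(1)])
  have "mob n vs \<otimes>\<^bsub>Mob n\<^esub> mob n vs = \<one>\<^bsub>Mob n\<^esub>"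
  proof (rule Mob_eqI)
    fix x assume x: "x \<in> hyp_space n"
    show "(mob n vs \<otimes>\<^bsub>Mob n\<^esub> mob n vs) x = \<one>\<^bsub>Mob n\<^esub> x"
      using x Mob_mult_apply[OF f f x] reflects_involution[OF vs hyp_spaceD(1)[OF x]] reflects_hyp[OF vs(1) x]
      by (simp add: one_Mob)
  qed (use f in auto)
  then have "mob n vs [^]\<^bsub>Mob n\<^esub> (2::nat) = \<one>\<^bsub>Mob n\<^esub>"
    using f by (simp add: numeral_2_eq_2)
  then have "G.ord (mob n vs) dvd 2" using f by (simp add: G.pow_eq_id)
  moreover have "G.ord (mob n vs) \<noteq> 1"
  proof
    assume "G.ord (mob n vs) = 1"
    then have e: "mob n vs = mob n []" using G.ord_eq_1[OF f] by (simp add: one_Mob)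
    have all_fixed: "reflects vs x = x" if "x \<in> hyp_space n" for x
      using fun_cong[OF e, of x] that by simp
    from k obtain v where v: "v \<in> set vs" by (cases vs) auto
    then have vD: "v \<in> carrier_vec (n + 1)" "lorentz v v > 0" using vs spacelikeD by blast+
    \<comment> \<open>If all points were fixed, then by linearity v would be fixed; but it is not orthogonal to itself.\<close>
    have "reflects vs v = reflects [] v"
      by (rule reflects_eq_near[OF vs(1) _ base_point[of n] vD(1)]) (use all_fixed base_point[of n] in auto)
    then show False using reflects_fixed_iff[OF vs vD(1)] v vD(2) by auto
  qed
  ultimately have ord: "G.ord (mob n vs) = 2"
    using two_is_prime_nat by (metis prime_nat_iff)
  have fp: "fixed_points n (mob n vs) = {x \<in> hyp_space n. \<forall>v \<in> set vs. lorentz x v = 0}"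
    using reflects_fixed_iff[OF vs] hyp_spaceD(1) by (auto simp: fixed_points_def)
  obtain p where p: "p \<in> hyp_space n" "reflects vs p = p"
  proof -
    let ?q = "unit_vec (n + 1) 0 :: real vec"
    let ?r = "reflects vs ?q"
    have q: "?q \<in> hyp_space n" by (rule base_point)
    have r: "?r \<in> hyp_space n" by (rule reflects_hyp[OF vs(1) q])
    note qD = hyp_spaceD[OF q] and rD = hyp_spaceD[OF r]
    have s: "?q + ?r \<in> carrier_vec (n + 1)" using qD(1) rD(1) by (rule add_carrier_vec)
    have "lorentz ?r ?q = lorentz ?q ?r" by (rule lorentz_comm) (use rD(1) in simp)
    then have "lorentz (?q + ?r) (?q + ?r) = - 2 + 2 * lorentz ?q ?r"
      using lorentz_add_left[OF qD(1) rD(1), of "?q + ?r"] lorentz_add_right[OF qD(1) rD(1) qD(1)]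
        lorentz_add_right[OF qD(1) rD(1) rD(1)] qD(2) rD(2) by simp
    then have neg: "lorentz (?q + ?r) (?q + ?r) < 0" using hyp_lorentz(1)[OF q r] by simp
    have "(?q + ?r) $ 0 = ?q $ 0 + ?r $ 0" using rD(1) by (intro index_add_vec) auto
    then have pos: "(?q + ?r) $ 0 > 0" using qD(3) rD(3) by linarith
    obtain c where c: "c \<cdot>\<^sub>v (?q + ?r) \<in> hyp_space n" by (rule timelike_scale[OF s neg pos])
    have "reflects vs (?q + ?r) = ?r + ?q"
      using reflects_add[OF vs(1) qD(1) rD(1)] reflects_involution[OF vs qD(1)] by simp
    also have "\<dots> = ?q + ?r" by (rule comm_add_vec[OF rD(1) qD(1)])
    finally have "reflects vs (c \<cdot>\<^sub>v (?q + ?r)) = c \<cdot>\<^sub>v (?q + ?r)"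
      using reflects_smult[OF vs(1) s, of c] by simp
    with c that show thesis by blast
  qed
  note pD = hyp_spaceD[OF p(1)]
  have po: "lorentz p v = 0" if "v \<in> set vs" for v
    using reflects_fixed_iff[OF vs pD(1)] p(2) that by simp
  obtain us where us: "length us = n - k" "set us \<subseteq> spacelike n" "orthogonal us"
    "\<And>u v. u \<in> set (p # vs) \<Longrightarrow> v \<in> set us \<Longrightarrow> lorentz v u = 0"
  proof (rule orthogonal_extension[of "p # vs" n "n - k"])
    show "set (p # vs) \<subseteq> carrier_vec (n + 1)" using pD(1) vs(1) spacelikeD by auto
    show "length (p # vs) + (n - k) \<le> n + 1" using k by simp
    show "v \<in> spacelike n" if "v \<in> carrier_vec (n + 1)" "v \<noteq> 0\<^sub>v (n + 1)"
      "\<And>u. u \<in> set (p # vs) \<Longrightarrow> lorentz v u = 0" for v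
      by (rule spacelike_orthogonal_timelike[OF p(1)]) (use that in auto)
  qed blast
  define B where "B = insert p (set us)"
  have "VS.lin_indpt {}" unfolding VS.lin_dep_def by simp
  then have "VS.lin_indpt {p}"
    using lin_indpt_insert_orthogonal(1)[of "{}" p] pD by simp
  then have B: "VS.lin_indpt B" "card B = (n - k) + 1"
    using lin_indpt_union_orthogonal[OF us(2,3), of "{p}"] us(1,4) pD(1) by (auto simp: B_def)
  have Bc: "B \<subseteq> carrier_vec (n + 1)" using pD(1) us(2) spacelikeD by (auto simp: B_def)
  have bv: "lorentz b v = 0" if "b \<in> B" "v \<in> set vs" for b v
    using that po us(4) by (auto simp: B_def)
  have "x \<in> VS.span B \<longleftrightarrow> (\<forall>v \<in> set vs. lorentz x v = 0)" if x: "x \<in> carrier_vec (n + 1)" for x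
  proof
    assume "x \<in> VS.span B"
    then show "\<forall>v \<in> set vs. lorentz x v = 0"
      using span_orthogonal[OF Bc _ bv] vs(1) spacelikeD by blast
  next
    assume xo: "\<forall>v \<in> set vs. lorentz x v = 0"
    have sw: "lorentz v y = 0" if "lorentz y v = 0" "v \<in> set vs" "y \<in> carrier_vec (n + 1)" for v y
      using that lorentz_comm[of v y] vs(1) spacelikeD(1)[of v n] by auto
    show "x \<in> VS.span B"
      by (rule span_orthogonal_complement[OF vs Bc B(1) _ _ _ x])
        (use B bv xo sw k Bc x in \<open>auto simp: B_def\<close>)
  qed
  then have "fixed_points n (mob n vs) = hyp_space n \<inter> VS.span B"
    unfolding fp using hyp_spaceD(1) by blast
  moreover have "p \<in> fixed_points n (mob n vs)" using p by (simp add: fixed_points_def)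
  ultimately have "tot_geodesic n (n - k) (fixed_points n (mob n vs))"
    unfolding tot_geodesic_def using B Bc by blast
  then show ?thesis
    unfolding k_involutions_def using f ord k(3) by (auto intro!: exI[of _ "n - k"])
qed

text \<open>The subspace through the fixed points has dimension \<open>n + 1 - k\<close>. Being spanned by points of the
  hyperboloid, it is fixed pointwise by the linear extension. Its orthogonal complement is positive
  definite, so it contains \<open>k\<close> pairwise orthogonal spacelike vectors, and these cut out the subspace.\<close>
lemma k_involution_fixes:
  assumes f: "f \<in> k_involutions k n"
  obtains vs ws where "set vs \<subseteq> spacelike n" "f = mob n vs"
    "set ws \<subseteq> carrier_vec (n + 1)" "length ws = k"
    "\<And>x. x \<in> carrier_vec (n + 1) \<Longrightarrow> (\<And>w. w \<in> set ws \<Longrightarrow> lorentz x w = 0) \<Longrightarrow> reflects vs x = x"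
proof -
  from f obtain d where fM: "f \<in> carrier (Mob n)" and d: "d + k = n" and tg: "tot_geodesic n d (fixed_points n f)"
    by (auto simp: k_involutions_def)
  from Mob_reflections[OF fM] obtain vs where vs: "set vs \<subseteq> spacelike n" "f = mob n vs" by blast
  from tg obtain B p where B: "B \<subseteq> carrier_vec (n + 1)" "card B = d + 1" "VS.lin_indpt B"
    and F: "fixed_points n f = hyp_space n \<inter> VS.span B" and "p \<in> fixed_points n f"
    unfolding tot_geodesic_def by blast
  then have p: "p \<in> hyp_space n" "p \<in> VS.span B" by auto
  have fB: "finite B" using B(2) by (metis Suc_eq_plus1 card.infinite nat.distinct(1))
  then obtain L where L: "set L = B" "distinct L" using finite_distinct_list by blast
  have lenL: "length L = d + 1" using L B(2) distinct_card by fastforce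
  have sym: "lorentz x y = lorentz y x" if "x \<in> carrier_vec (n + 1)" "y \<in> carrier_vec (n + 1)" for x y
    using that by (simp add: lorentz_comm)
  obtain ws where ws: "length ws = k" "set ws \<subseteq> spacelike n" "orthogonal ws"
    "\<And>u v. u \<in> set L \<Longrightarrow> v \<in> set ws \<Longrightarrow> lorentz v u = 0"
  proof (rule orthogonal_extension[of L n k])
    show "set L \<subseteq> carrier_vec (n + 1)" using L B by simp
    show "length L + k \<le> n + 1" using lenL d by simp
    show "v \<in> spacelike n" if v: "v \<in> carrier_vec (n + 1)" "v \<noteq> 0\<^sub>v (n + 1)"
      "\<And>u. u \<in> set L \<Longrightarrow> lorentz v u = 0" for v
    proof (rule spacelike_orthogonal_timelike[OF p(1) v(1) _ v(2)])
      have "lorentz b v = 0" if b: "b \<in> B" for b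
        using v(3)[of b] b L(1) B(1) sym[OF v(1), of b] by auto
      then have "lorentz p v = 0" by (rule span_orthogonal[OF B(1) v(1) _ p(2)])
      then show "lorentz v p = 0" using sym[OF v(1) hyp_spaceD(1)[OF p(1)]] by simp
    qed
  qed blast
  have wc: "set ws \<subseteq> carrier_vec (n + 1)" using ws(2) spacelikeD by blast
  have fixB: "reflects vs y = y" if "y \<in> hyp_space n" "y \<in> VS.span B" for y
  proof -
    have "y \<in> fixed_points n f" using F that by blast
    then show ?thesis using vs(2) that(1) by (simp add: fixed_points_def)
  qed
  have "reflects vs x = x" if x: "x \<in> carrier_vec (n + 1)" "\<And>w. w \<in> set ws \<Longrightarrow> lorentz x w = 0" for x
  proof -
    have xB: "x \<in> VS.span B"
    proof (rule span_orthogonal_complement[OF ws(2,3) B(1,3) fB _ _ x(1)])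
      show "card B + length ws = n + 1" using B ws(1) d by simp
      show "lorentz v b = 0" if "b \<in> B" "v \<in> set ws" for b v using ws(4) that L(1) by blast
      show "lorentz v x = 0" if "v \<in> set ws" for v using x(2)[OF that] sym[OF x(1), of v] that wc by auto
    qed
    have "reflects vs x = reflects [] x"
    proof (rule reflects_eq_near[OF vs(1) _ p(1) x(1)])
      show "reflects vs p = reflects [] p" using fixB p by simp
      fix c e assume h: "c \<cdot>\<^sub>v (p + e \<cdot>\<^sub>v x) \<in> hyp_space n"
      have "c \<cdot>\<^sub>v (p + e \<cdot>\<^sub>v x) \<in> VS.span B"
        using VS.smult_in_span[OF B(1)] VS.span_add1[OF B(1) p(2)] xB by simp
      then show "reflects vs (c \<cdot>\<^sub>v (p + e \<cdot>\<^sub>v x)) = reflects [] (c \<cdot>\<^sub>v (p + e \<cdot>\<^sub>v x))"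
        using fixB h by simp
    qed simp
    then show ?thesis by simp
  qed
  with vs wc ws(1) that show thesis by blast
qed

end

section \<open>The lower bound\<close>

definition axes :: "nat \<Rightarrow> nat \<Rightarrow> real vec list" where
  "axes n m = map (unit_vec (n + 1)) [1..<m + 1]"

lemma axes_orthogonal:
  assumes "m \<le> n"
  shows "set (axes n m) \<subseteq> spacelike n" "orthogonal (axes n m)" "length (axes n m) = m"
proof -
  show "set (axes n m) \<subseteq> spacelike n"
    using assms spacelike_unit[of _ n] by (auto simp: axes_def simp del: upt_Suc)
  have "lorentz (unit_vec (n + 1) i) (unit_vec (n + 1) j) = 0" if "i < j" "j \<le> m" for i j
    using lorentz_unit_pos[of "unit_vec (n + 1) i" n j] that assms by (simp add: unit_vec_def)
  moreover have "sorted_wrt (<) [1..<m + 1]" by (rule sorted_wrt_upt)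
  ultimately show "orthogonal (axes n m)"
    unfolding axes_def sorted_wrt_map
    by (elim sorted_wrt_mono_rel[rotated]) (auto simp del: upt_Suc)
  show "length (axes n m) = m" by (simp add: axes_def)
qed

text \<open>The conditions for being fixed are collected factor by factor; a vector satisfying all of them
  passes unchanged through every factor.\<close>
lemma word_fixes:
  "set fs \<subseteq> k_involutions k n \<Longrightarrow>
    \<exists>vs ws. set vs \<subseteq> spacelike n \<and> foldr (\<lambda>x y. x \<otimes>\<^bsub>Mob n\<^esub> y) fs \<one>\<^bsub>Mob n\<^esub> = mob n vs \<and>
      set ws \<subseteq> carrier_vec (n + 1) \<and> length ws = k * length fs \<and>
      (\<forall>x \<in> carrier_vec (n + 1). (\<forall>w \<in> set ws. lorentz x w = 0) \<longrightarrow> reflects vs x = x)"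
proof (induction fs)
  case Nil
  show ?case by (intro exI[of _ "[]"]) (simp add: one_Mob)
next
  case (Cons f fs)
  then obtain vs ws where IH: "set vs \<subseteq> spacelike n"
      "foldr (\<lambda>x y. x \<otimes>\<^bsub>Mob n\<^esub> y) fs \<one>\<^bsub>Mob n\<^esub> = mob n vs"
      "set ws \<subseteq> carrier_vec (n + 1)" "length ws = k * length fs"
      "\<forall>x \<in> carrier_vec (n + 1). (\<forall>w \<in> set ws. lorentz x w = 0) \<longrightarrow> reflects vs x = x"
    by auto
  from Cons.prems have "f \<in> k_involutions k n" by simp
  then obtain us zs where f: "set us \<subseteq> spacelike n" "f = mob n us"
    "set zs \<subseteq> carrier_vec (n + 1)" "length zs = k"
    "\<And>x. x \<in> carrier_vec (n + 1) \<Longrightarrow> (\<And>w. w \<in> set zs \<Longrightarrow> lorentz x w = 0) \<Longrightarrow> reflects us x = x"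
    by (rule k_involution_fixes) blast
  have "foldr (\<lambda>x y. x \<otimes>\<^bsub>Mob n\<^esub> y) (f # fs) \<one>\<^bsub>Mob n\<^esub> = mob n (us @ vs)"
    using mob_append[OF f(1) IH(1)] IH(2) f(2) by simp
  then show ?case
    using IH f by (intro exI[of _ "us @ vs"] exI[of _ "zs @ ws"]) auto
qed

text \<open>If \<open>k * length fs < m\<close>, then some nonzero vector supported on coordinates \<open>1, \<dots>, m\<close> satisfies the
  \<open>k * length fs\<close> conditions, so it is fixed by the word. The product of the axis reflections sends
  it to its negative.\<close>
lemma length_of_word_axes:
  assumes m: "m \<le> n" and fs: "set fs \<subseteq> k_involutions k n"
    and eq: "foldr (\<lambda>x y. x \<otimes>\<^bsub>Mob n\<^esub> y) fs \<one>\<^bsub>Mob n\<^esub> = mob n (axes n m)"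
  shows "m \<le> k * length fs"
proof (rule ccontr)
  assume less: "\<not> m \<le> k * length fs"
  from word_fixes[OF fs] eq obtain vs ws where vs: "set vs \<subseteq> spacelike n" "mob n (axes n m) = mob n vs"
    and ws: "set ws \<subseteq> carrier_vec (n + 1)" "length ws = k * length fs"
      "\<And>x. x \<in> carrier_vec (n + 1) \<Longrightarrow> (\<And>w. w \<in> set ws \<Longrightarrow> lorentz x w = 0) \<Longrightarrow> reflects vs x = x"
    by auto
  note ax = axes_orthogonal[OF m]
  let ?L = "ws @ unit_vec (n + 1) 0 # map (unit_vec (n + 1)) [m + 1..<n + 1]"
  have "set ?L \<subseteq> carrier_vec (n + 1)" using ws(1) by auto
  moreover have "length ?L < n + 1"
  proof -
    have "length ?L = k * length fs + 1 + (n - m)" using ws(2) m by (simp del: upt_Suc)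
    then show ?thesis using less m by linarith
  qed
  ultimately obtain x where x: "x \<in> carrier_vec (n + 1)" "x \<noteq> 0\<^sub>v (n + 1)" "\<And>u. u \<in> set ?L \<Longrightarrow> lorentz x u = 0"
    by (rule exists_orthogonal) blast
  have e: "reflects (axes n m) y = reflects vs y" if "y \<in> hyp_space n" for y
    using fun_cong[OF vs(2), of y] that by simp
  have "reflects (axes n m) x = reflects vs x"
    by (rule reflects_eq_near[OF ax(1) vs(1) base_point x(1)]) (use e base_point in auto)
  also have "\<dots> = x" using ws(3) x by auto
  finally have o: "\<forall>v \<in> set (axes n m). lorentz x v = 0" using reflects_fixed_iff[OF ax(1,2) x(1)] by simp
  have "lorentz x (unit_vec (n + 1) i) = 0" if i: "i < n + 1" for i
  proof -
    consider "i = 0" | "i \<in> {1..<m + 1}" | "i \<in> {m + 1..<n + 1}" using i by fastforce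
    then show ?thesis
    proof cases
      case 2
      then have "unit_vec (n + 1) i \<in> set (axes n m)" by (auto simp: axes_def simp del: upt_Suc)
      then show ?thesis using o by blast
    next
      case 3
      then have "unit_vec (n + 1) i \<in> set ?L" by (auto simp del: upt_Suc)
      then show ?thesis using x(3) by blast
    qed (use x(3) in simp)
  qed
  then show False using lorentz_nondegenerate[OF x(1)] x(2) by blast
qed

lemma word_length_attained:
  assumes l: "word_length M S g = enat l"
  obtains ws where "length ws = l" "set ws \<subseteq> S" "foldr (\<lambda>x y. x \<otimes>\<^bsub>M\<^esub> y) ws \<one>\<^bsub>M\<^esub> = g"
proof -
  let ?W = "{enat (length ws) | ws. set ws \<subseteq> S \<and> foldr (\<lambda>x y. x \<otimes>\<^bsub>M\<^esub> y) ws \<one>\<^bsub>M\<^esub> = g}"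
  have I: "Inf ?W = enat l" using l unfolding word_length_def .
  have ne: "?W \<noteq> {}"
  proof
    assume "?W = {}"
    then have "Inf ?W = Inf {}" by (rule arg_cong)
    then show False unfolding I by (simp add: top_enat_def)
  qed
  then obtain w where "w \<in> ?W" by blast
  then have "(LEAST x. x \<in> ?W) \<in> ?W" by (rule LeastI)
  moreover have "Inf ?W = (LEAST x. x \<in> ?W)" unfolding Inf_enat_def by (rule if_not_P[OF ne])
  ultimately have "enat l \<in> ?W" using I by metis
  then show thesis using that by auto
qed

lemma inv_length_lower:
  assumes k: "1 \<le> k" and n: "2 \<le> n" and G: "Mob_plus n \<subseteq> G"
  shows "ereal (1 / (2 * real k) * real n) \<le> ereal_of_enat (inv_length k n G)"
proof -
  \<comment> \<open>An even number of axes, so that the isometry preserves orientation.\<close>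
  define m where "m = 2 * (n div 2)"
  have m: "m \<le> n" "even m" "2 * m \<ge> n" using n by (auto simp: m_def)
  note ax = axes_orthogonal[OF m(1)]
  let ?g = "mob n (axes n m)"
  have "?g \<in> Mob_plus n"
    using mob_closed[OF ax(1)] orientation_preserving_mob[OF _ ax(1)] ax(3) m(2) n by (simp add: Mob_plus_def)
  then have "word_length (Mob n) (k_involutions k n) ?g \<le> inv_length k n G"
    using G unfolding inv_length_def set_length_def by (intro SUP_upper) auto
  moreover have "ereal (1 / (2 * real k) * real n) \<le> ereal_of_enat (word_length (Mob n) (k_involutions k n) ?g)"
  proof (cases "word_length (Mob n) (k_involutions k n) ?g")
    case (enat l)
    then obtain fs where fs: "length fs = l" "set fs \<subseteq> k_involutions k n"
      "foldr (\<lambda>x y. x \<otimes>\<^bsub>Mob n\<^esub> y) fs \<one>\<^bsub>Mob n\<^esub> = ?g"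
      by (rule word_length_attained)
    have "m \<le> k * l" using length_of_word_axes[OF m(1) fs(2,3)] fs(1) by simp
    then have "n \<le> 2 * (k * l)" using m(3) by linarith
    then have "real n \<le> 2 * (real k * real l)" by (metis of_nat_le_iff of_nat_mult of_nat_numeral)
    then have "1 / (2 * real k) * real n \<le> real l" using k by (simp add: field_simps)
    then show ?thesis using enat by simp
  qed simp
  ultimately show ?thesis by (meson ereal_of_enat_le_iff order_trans)
qed

section \<open>The upper bound\<close>

definition word_within :: "nat \<Rightarrow> nat \<Rightarrow> nat \<Rightarrow> (real vec \<Rightarrow> real vec) \<Rightarrow> bool" where
  "word_within k n m f \<longleftrightarrow> (\<exists>fs. set fs \<subseteq> k_involutions k n \<and> length fs \<le> m \<and>
     foldr (\<lambda>x y. x \<otimes>\<^bsub>Mob n\<^esub> y) fs \<one>\<^bsub>Mob n\<^esub> = f)"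

lemma word_within_one: "word_within k n 0 (mob n [])"
  unfolding word_within_def by (intro exI[of _ "[]"]) (simp add: one_Mob)

lemma word_within_mono: "word_within k n m f \<Longrightarrow> m \<le> m' \<Longrightarrow> word_within k n m' f"
  unfolding word_within_def using order_trans by blast

lemma word_within_append:
  assumes "word_within k n l (mob n us)" "word_within k n m (mob n vs)"
    and "set us \<subseteq> spacelike n" "set vs \<subseteq> spacelike n"
  shows "word_within k n (l + m) (mob n (us @ vs))"
proof -
  interpret group "Mob n" by (rule Mob_group)
  have kc: "k_involutions k n \<subseteq> carrier (Mob n)" by (auto simp: k_involutions_def)
  obtain fs gs where fs: "set fs \<subseteq> k_involutions k n" "length fs \<le> l"
      "foldr (\<lambda>x y. x \<otimes>\<^bsub>Mob n\<^esub> y) fs \<one>\<^bsub>Mob n\<^esub> = mob n us"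
    and gs: "set gs \<subseteq> k_involutions k n" "length gs \<le> m"
      "foldr (\<lambda>x y. x \<otimes>\<^bsub>Mob n\<^esub> y) gs \<one>\<^bsub>Mob n\<^esub> = mob n vs"
    using assms unfolding word_within_def by blast
  have closed: "foldr (\<lambda>x y. x \<otimes>\<^bsub>Mob n\<^esub> y) hs \<one>\<^bsub>Mob n\<^esub> \<in> carrier (Mob n)"
    if "set hs \<subseteq> carrier (Mob n)" for hs
    using that by (induction hs) auto
  have "foldr (\<lambda>x y. x \<otimes>\<^bsub>Mob n\<^esub> y) (hs @ gs) \<one>\<^bsub>Mob n\<^esub> =
      foldr (\<lambda>x y. x \<otimes>\<^bsub>Mob n\<^esub> y) hs \<one>\<^bsub>Mob n\<^esub> \<otimes>\<^bsub>Mob n\<^esub> mob n vs"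
    if "set hs \<subseteq> carrier (Mob n)" for hs
    using that
  proof (induction hs)
    case Nil
    then show ?case using gs(3) mob_closed[OF assms(4)] by simp
  next
    case (Cons h hs)
    then show ?case using closed[of hs] mob_closed[OF assms(4)] by (simp add: m_assoc)
  qed
  from this[of fs] have "foldr (\<lambda>x y. x \<otimes>\<^bsub>Mob n\<^esub> y) (fs @ gs) \<one>\<^bsub>Mob n\<^esub> = mob n (us @ vs)"
    using fs kc mob_append[OF assms(3,4)] by auto
  then show ?thesis
    unfolding word_within_def using fs gs by (intro exI[of _ "fs @ gs"]) auto
qed

lemma word_within_orthogonal:
  assumes "set vs \<subseteq> spacelike n" "orthogonal vs" "length vs = k" "1 \<le> k" "k \<le> n"
  shows "word_within k n 1 (mob n vs)"
proof -
  have f: "mob n vs \<in> k_involutions k n" by (rule k_involution_mob[OF assms])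
  interpret group "Mob n" by (rule Mob_group)
  have "mob n vs \<in> carrier (Mob n)" using f by (simp add: k_involutions_def)
  with f show ?thesis
    unfolding word_within_def by (intro exI[of _ "[mob n vs]"]) simp
qed

lemma mob_cong:
  assumes "\<And>x. x \<in> carrier_vec (n + 1) \<Longrightarrow> reflects us x = reflects vs x"
  shows "mob n us = mob n vs"
  unfolding mob_def using assms hyp_spaceD(1) by (intro restrict_ext) blast

text \<open>Including the time axis among the prescribed vectors makes all new vectors spacelike, at the
  cost of one dimension. Two vectors can therefore be extended by \<open>k - 1\<close> more as
  soon as \<open>k + 1 \<le> n\<close>.\<close>
lemma orthogonal_extension_off_axis:
  assumes L: "set L \<subseteq> carrier_vec (n + 1)" and len: "length L + m \<le> n"
  obtains vs where "length vs = m" "set vs \<subseteq> spacelike n" "orthogonal vs"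
    "\<And>u v. u \<in> set L \<Longrightarrow> v \<in> set vs \<Longrightarrow> lorentz v u = 0"
proof (rule orthogonal_extension[of "unit_vec (n + 1) 0 # L" n m])
  show "v \<in> spacelike n" if v: "v \<in> carrier_vec (n + 1)" "v \<noteq> 0\<^sub>v (n + 1)"
    "\<And>u. u \<in> set (unit_vec (n + 1) 0 # L) \<Longrightarrow> lorentz v u = 0" for v
    using spacelike_orthogonal_timelike[OF base_point v(1) _ v(2)] v(3) by auto
qed (use L len that in auto)

text \<open>The two \<open>k\<close>-involutions share \<open>k - 1\<close> reflections, which cancel in the middle of the product.\<close>
lemma word_within_orthogonal_pair:
  assumes k: "1 \<le> k" "k + 1 \<le> n" and u: "u \<in> spacelike n" and v: "v \<in> spacelike n" and o: "lorentz u v = 0"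
  shows "word_within k n 2 (mob n [u, v])"
proof -
  note uD = spacelikeD[OF u] and vD = spacelikeD[OF v]
  obtain vs where vs: "length vs = k - 1" "set vs \<subseteq> spacelike n" "orthogonal vs"
    "\<And>z w. z \<in> set [u, v] \<Longrightarrow> w \<in> set vs \<Longrightarrow> lorentz w z = 0"
    by (rule orthogonal_extension_off_axis[of "[u, v]" n "k - 1"]) (use k uD(1) vD(1) in auto)
  have "lorentz u w = 0" if "w \<in> set vs" for w
  proof -
    have "lorentz u w = lorentz w u"
      by (rule lorentz_comm) (use that uD vs(2) spacelikeD(1)[of w n] in auto)
    then show ?thesis using vs(4) that by simp
  qed
  then have 1: "word_within k n 1 (mob n (u # vs))"
    using vs u k by (intro word_within_orthogonal) auto
  have 2: "word_within k n 1 (mob n (vs @ [v]))"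
    using vs v k by (intro word_within_orthogonal) (auto simp: sorted_wrt_append)
  have "word_within k n (1 + 1) (mob n ((u # vs) @ (vs @ [v])))"
    by (rule word_within_append[OF 1 2]) (use u v vs in auto)
  moreover have "mob n ((u # vs) @ (vs @ [v])) = mob n [u, v]"
    using reflects_involution[OF vs(2,3)] reflect_carrier[OF vD(1)] by (intro mob_cong) simp
  ultimately show ?thesis by (simp add: numeral_2_eq_2)
qed

text \<open>For \<open>k \<ge> 2\<close> there is room for a spacelike \<open>w\<close> orthogonal to both \<open>u\<close> and \<open>v\<close>; inserting the
  reflection in \<open>w\<close> twice splits the product into two orthogonal pairs.\<close>
lemma word_within_pair:
  assumes k: "2 \<le> k" "k + 1 \<le> n" and u: "u \<in> spacelike n" and v: "v \<in> spacelike n"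
  shows "word_within k n 4 (mob n [u, v])"
proof -
  note uD = spacelikeD[OF u] and vD = spacelikeD[OF v]
  obtain ws where ws: "length ws = 1" "set ws \<subseteq> spacelike n"
    "\<And>z w. z \<in> set [u, v] \<Longrightarrow> w \<in> set ws \<Longrightarrow> lorentz w z = 0"
    by (rule orthogonal_extension_off_axis[of "[u, v]" n 1]) (use k uD(1) vD(1) in auto)
  then obtain w where w: "w \<in> spacelike n" "lorentz w u = 0" "lorentz w v = 0"
    by (cases ws) auto
  have "lorentz u w = lorentz w u" by (rule lorentz_comm) (use uD spacelikeD(1)[OF w(1)] in simp)
  then have 1: "word_within k n 2 (mob n [u, w])"
    using word_within_orthogonal_pair[OF _ k(2) u w(1)] k w by simp
  have 2: "word_within k n 2 (mob n [w, v])"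
    using word_within_orthogonal_pair[OF _ k(2) w(1) v w(3)] k by simp
  have "word_within k n (2 + 2) (mob n ([u, w] @ [w, v]))"
    by (rule word_within_append[OF 1 2]) (use u v w in auto)
  moreover have "mob n ([u, w] @ [w, v]) = mob n [u, v]"
    using reflect_reflect[OF w(1) reflect_carrier[OF vD(1)]] by (intro mob_cong) simp
  ultimately show ?thesis by simp
qed

lemma word_within_even:
  assumes k: "2 \<le> k" "k + 1 \<le> n" and "set vs \<subseteq> spacelike n" "even (length vs)"
  shows "word_within k n (2 * length vs) (mob n vs)"
  using assms(3,4)
proof (induction vs rule: induct_list012)
  case 1
  show ?case using word_within_one by simp
next
  case (3 u v vs)
  have 1: "word_within k n 4 (mob n [u, v])" by (rule word_within_pair[OF k]) (use 3 in auto)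
  have 2: "word_within k n (2 * length vs) (mob n vs)" using 3 by simp
  have "word_within k n (4 + 2 * length vs) (mob n ([u, v] @ vs))"
    by (rule word_within_append[OF 1 2]) (use 3 in auto)
  moreover have "4 + 2 * length vs = 2 * length (u # v # vs)" by simp
  ultimately show ?case by (simp only: append_Cons append_Nil)
qed simp

text \<open>For orthogonal lists no auxiliary vector is needed between the two members of a pair. So the
  count is one per reflection, and \<open>k = 1\<close> is covered.\<close>
lemma word_within_orthogonal_even:
  assumes k: "1 \<le> k" "k + 1 \<le> n" and "set vs \<subseteq> spacelike n" "orthogonal vs" "even (length vs)"
  shows "word_within k n (length vs) (mob n vs)"
  using assms(3,4,5)
proof (induction vs rule: induct_list012)
  case 1
  show ?case using word_within_one by simp
next
  case (3 u v vs)
  have 1: "word_within k n 2 (mob n [u, v])" by (rule word_within_orthogonal_pair[OF k]) (use 3 in auto)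
  have 2: "word_within k n (length vs) (mob n vs)" using 3 by simp
  have "word_within k n (2 + length vs) (mob n ([u, v] @ vs))"
    by (rule word_within_append[OF 1 2]) (use 3 in auto)
  then show ?case by simp
qed simp

text \<open>With \<open>v\<close> extended to an orthogonal list of length \<open>k\<close>, the reflection in \<open>v\<close> is the
  \<open>k\<close>-involution of that list times the product of the other \<open>k - 1\<close> reflections, an even number.\<close>
lemma word_within_reflection:
  assumes k: "odd k" "k + 1 \<le> n" and v: "v \<in> spacelike n"
  shows "word_within k n k (mob n [v])"
proof -
  have k1: "1 \<le> k" using k(1) by (cases k) auto
  note vD = spacelikeD[OF v]
  obtain vs where vs: "length vs = k - 1" "set vs \<subseteq> spacelike n" "orthogonal vs"
    "\<And>z w. z \<in> set [v] \<Longrightarrow> w \<in> set vs \<Longrightarrow> lorentz w z = 0"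
    by (rule orthogonal_extension_off_axis[of "[v]" n "k - 1"]) (use k vD(1) in auto)
  have "lorentz v w = 0" if "w \<in> set vs" for w
  proof -
    have "lorentz v w = lorentz w v"
      by (rule lorentz_comm) (use that vD vs(2) spacelikeD(1)[of w n] in auto)
    then show ?thesis using vs(4) that by simp
  qed
  then have 1: "word_within k n 1 (mob n (v # vs))"
    using vs v k k1 by (intro word_within_orthogonal) auto
  have 2: "word_within k n (length vs) (mob n vs)"
    using vs k k1 by (intro word_within_orthogonal_even) auto
  have "word_within k n (1 + length vs) (mob n ((v # vs) @ vs))"
    by (rule word_within_append[OF 1 2]) (use v vs in auto)
  moreover have "mob n ((v # vs) @ vs) = mob n [v]"
    using reflects_involution[OF vs(2,3)] by (intro mob_cong) simp
  ultimately show ?thesis using vs(1) k1 by simp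
qed

lemma word_within_odd:
  assumes k: "odd k" "k + 1 \<le> n" and "set vs \<subseteq> spacelike n"
  shows "word_within k n (k * length vs) (mob n vs)"
  using assms(3)
proof (induction vs)
  case Nil
  show ?case using word_within_one by simp
next
  case (Cons v vs)
  have 1: "word_within k n k (mob n [v])" by (rule word_within_reflection[OF k]) (use Cons in auto)
  have 2: "word_within k n (k * length vs) (mob n vs)" using Cons by simp
  have "word_within k n (k + k * length vs) (mob n ([v] @ vs))"
    by (rule word_within_append[OF 1 2]) (use Cons in auto)
  then show ?case by simp
qed

lemma inv_length_upper:
  assumes "\<And>f. f \<in> G \<Longrightarrow> word_within k n N f" and "real N \<le> c"
  shows "ereal_of_enat (inv_length k n G) \<le> ereal c"
proof -
  have "word_length (Mob n) (k_involutions k n) f \<le> enat N" if "f \<in> G" for f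
  proof -
    from assms(1)[OF that] obtain fs where fs: "set fs \<subseteq> k_involutions k n" "length fs \<le> N"
      "foldr (\<lambda>x y. x \<otimes>\<^bsub>Mob n\<^esub> y) fs \<one>\<^bsub>Mob n\<^esub> = f"
      unfolding word_within_def by blast
    then have "word_length (Mob n) (k_involutions k n) f \<le> enat (length fs)"
      unfolding word_length_def by (intro Inf_lower) blast
    also have "\<dots> \<le> enat N" using fs(2) by simp
    finally show ?thesis .
  qed
  then have "inv_length k n G \<le> enat N"
    unfolding inv_length_def set_length_def by (intro SUP_least) auto
  then have "ereal_of_enat (inv_length k n G) \<le> ereal_of_enat (enat N)" by (simp only: ereal_of_enat_le_iff)
  also have "\<dots> \<le> ereal c" using assms(2) by simp
  finally show ?thesis .
qed

text \<open>Both lower constants are \<open>1 / (2 k)\<close>; the upper ones come from \<open>2 (n + 1) \<le> 4 n\<close> and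
  \<open>k (n + 1) \<le> 2 k n\<close>.\<close>
theorem corollary1p2:
  fixes k :: nat
  assumes "k \<ge> 1"
  shows "(even k \<longrightarrow>
           (\<exists>c C :: real. c > 0 \<and> C > 0 \<and>
             (\<forall>n :: nat. n \<ge> 2 \<and> n \<ge> k + 1 \<longrightarrow>
               ereal (c * real n) \<le> ereal_of_enat (inv_length k n (Mob_plus n)) \<and>
               ereal_of_enat (inv_length k n (Mob_plus n)) \<le> ereal (C * real n)))) \<and>
         (odd k \<longrightarrow>
           (\<exists>c C :: real. c > 0 \<and> C > 0 \<and>
             (\<forall>n :: nat. n \<ge> 2 \<and> n \<ge> k + 1 \<longrightarrow>
               ereal (c * real n) \<le> ereal_of_enat (inv_length k n (carrier (Mob n))) \<and>
               ereal_of_enat (inv_length k n (carrier (Mob n))) \<le> ereal (C * real n))))"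
proof (intro conjI impI)
  assume ev: "even k"
  then have k: "2 \<le> k" using assms by (cases "k = 1") auto
  have "ereal_of_enat (inv_length k n (Mob_plus n)) \<le> ereal (4 * real n)" if n: "2 \<le> n" "k + 1 \<le> n" for n
  proof (rule inv_length_upper)
    fix f assume f: "f \<in> Mob_plus n"
    then have "f \<in> carrier (Mob n)" by (simp add: Mob_plus_def)
    then obtain vs where vs: "set vs \<subseteq> spacelike n" "length vs \<le> n + 1" "f = mob n vs"
      by (rule Mob_reflections)
    have "even (length vs)"
      using f orientation_preserving_mob[OF _ vs(1)] n vs(3) by (simp add: Mob_plus_def)
    then have "word_within k n (2 * length vs) f"
      using word_within_even[OF k n(2) vs(1)] vs(3) by simp
    then show "word_within k n (2 * (n + 1)) f"
      by (rule word_within_mono) (use vs in simp)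
  qed (use n in simp)
  then show "\<exists>c C :: real. c > 0 \<and> C > 0 \<and>
             (\<forall>n :: nat. n \<ge> 2 \<and> n \<ge> k + 1 \<longrightarrow>
               ereal (c * real n) \<le> ereal_of_enat (inv_length k n (Mob_plus n)) \<and>
               ereal_of_enat (inv_length k n (Mob_plus n)) \<le> ereal (C * real n))"
    using inv_length_lower[OF assms] assms
    by (intro exI[of _ "1 / (2 * real k)"] exI[of _ 4]) simp
next
  assume od: "odd k"
  have "ereal_of_enat (inv_length k n (carrier (Mob n))) \<le> ereal (2 * real k * real n)"
    if n: "2 \<le> n" "k + 1 \<le> n" for n
  proof (rule inv_length_upper)
    fix f assume "f \<in> carrier (Mob n)"
    then obtain vs where vs: "set vs \<subseteq> spacelike n" "length vs \<le> n + 1" "f = mob n vs"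
      by (rule Mob_reflections)
    then have "word_within k n (k * length vs) f"
      using word_within_odd[OF od n(2) vs(1)] by simp
    then show "word_within k n (k * (n + 1)) f"
      by (rule word_within_mono) (rule mult_le_mono2[OF vs(2)])
  next
    have "k * (n + 1) \<le> 2 * k * n" using n by simp
    then show "real (k * (n + 1)) \<le> 2 * real k * real n"
      by (metis of_nat_le_iff of_nat_mult of_nat_numeral)
  qed
  moreover have "Mob_plus n \<subseteq> carrier (Mob n)" for n by (auto simp: Mob_plus_def)
  ultimately show "\<exists>c C :: real. c > 0 \<and> C > 0 \<and>
             (\<forall>n :: nat. n \<ge> 2 \<and> n \<ge> k + 1 \<longrightarrow>
               ereal (c * real n) \<le> ereal_of_enat (inv_length k n (carrier (Mob n))) \<and>
               ereal_of_enat (inv_length k n (carrier (Mob n))) \<le> ereal (C * real n))"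
    using inv_length_lower[OF assms] assms
    by (intro exI[of _ "1 / (2 * real k)"] exI[of _ "2 * real k"]) simp
qed

end
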